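(* In the setting described in the context, consider the operators $$\mathcal P_1=P(\epsilon t^2\partial_t)\partial_z^S-\sum_{\underline k=(k_0,k_1,k_2)\in\mathcal A}c_{\underline k}(z,\epsilon)\,m_{k_2,t,\epsilon}\,(t^2\partial_t)^{k_0}\partial_z^{k_1},\qquad \mathcal P_2=P_{\mathcal B}(\epsilon t^2\partial_t)\partial_z^{S_{\mathcal B}}-\sum_{\underline l=(l_0,l_1,l_2)\in\mathcal B}d_{\underline l}(z,\epsilon)\,t^{l_0}\partial_t^{l_1}\partial_z^{l_2},$$ where $m_{k_2,t,\epsilon}$ is the Moebius operator $m_{k_2,t,\epsilon}(u(t,z,\epsilon))=u\left(\frac t{1+k_2\epsilon t},z,\epsilon\right)$. Then the functions $y_{\mathcal E}$, for $\mathcal E=\mathcal E_{HJ_n}^k$ ($k\in\llbracket -n,n\rrbracket$) and $\mathcal E=\mathcal E_{S_{d_p}}$ ($0\le p\le\iota-1$), are holomorphic solutions of the Cauchy problem $$\mathcal P_1\mathcal P_2\,y(t,z,\epsilon)=0,$$ whose coefficients are holomorphic with respect to $z$ and $\epsilon$ on a neighborhood of the origin and polynomial in $t$, under the constraints $$(\partial_z^jy)(t,0,\epsilon)=\psi_{j,\mathcal E}(t,\epsilon),\ 0\le j\le S_{\mathcal B}-1,\qquad(\partial_z^j\mathcal P_2y)(t,0,\epsilon)=\varphi_{j,\mathcal E}(t,\epsilon),\ 0\le j\le S-1.$$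
   Context: Notation: $D(0,r)$, $\bar D(0,r)$ are the open and closed discs in $\mathbb C$; $\dot D(0,\epsilon_0)=D(0,\epsilon_0)\setminus\{0\}$; $\mathbb C_+=\{\mathrm{Re}(z)>0\}$; $\llbracket -n,n\rrbracket$ is the set of integers $m$ with $-n\le m\le n$; $\mathring X$ is the interior of $X$. First problem. $\mathcal A\subset\mathbb N^3$ is finite; for $\underline k=(k_0,k_1,k_2)\in\mathcal A$, $c_{\underline k}(z,\epsilon)$ is bounded holomorphic on $D(0,\rho)\times D(0,\epsilon_0)$; $S\ge1$ is an integer; $P$ is a complex polynomial, not identically $0$, with all roots in $\mathbb C_+$: $$(E1)\quad P(\epsilon t^2\partial_t)\partial_z^Su(t,z,\epsilon)=\sum_{\underline k\in\mathcal A}c_{\underline k}(z,\epsilon)\left((t^2\partial_t)^{k_0}\partial_z^{k_1}u\right)\left(\frac{t}{1+k_2\epsilon t},z,\epsilon\right).$$ There are $\xi>0$, $b>1$ with $S\ge k_1+bk_0+\frac{bk_2}{\xi}$, $S>k_1$ for all $\underline k\in\mathcal A$. Put $\zeta(b)=\sum_{m\ge0}(m+1)^{-b}$, fix $M>\zeta(b)$. Strips. $n\ge1$; for $k\in\llbracket -n,n\rrbracket$, $H_k=\{a_k\le\mathrm{Im}(z)\le b_k,\mathrm{Re}(z)\le0\}$, $J_k=\{c_k\le\mathrm{Im}(z)\le d_k,\mathrm{Re}(z)\le0\}$, with $0\in(c_0,d_0)$; $c_k<a_k<d_k$, $c_{k+1}<b_k<d_{k+1}$ for $-n\le k\le n-1$,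 $c_n<a_n<d_n$, $b_n>d_n$; $a_{k+1}>b_k$, $c_{k+1}>d_k$ for $-n\le k\le n-1$; $a_k\ne0$. $HJ_n=\{c_{-n}\le\mathrm{Im}(z)\le b_n,\mathrm{Re}(z)\le0\}$. Norms. $\underline\sigma'=(\sigma_1',\sigma_2',\sigma_3')$, $\underline\varsigma'=(\sigma_1',\varsigma_2',\varsigma_3')$ have positive entries and $\xi\le\min(\sigma_3',\varsigma_3')$. For a set $X$ and $\epsilon\in\dot D(0,\epsilon_0)$ (quotients at $\tau\ne0$): $\|v\|_{(0,\underline\sigma',X,\epsilon)}=\sup_{X}\frac{|v(\tau)|}{|\tau|}\exp(-\frac{\sigma_1'}{|\epsilon|}|\tau|+\sigma_2'(M-1)e^{\sigma_3'|\tau|})$ (used for $X=H_k$); $\|v\|_{(0,\underline\varsigma',X,\epsilon)}=\sup_{X}\frac{|v(\tau)|}{|\tau|}\exp(-\frac{\sigma_1'}{|\epsilon|}|\tau|-\varsigma_2'e^{\varsigma_3'|\tau|})$ (used for $X=J_k$ and $X=RJ_k$ below); $\|v\|_{(0,\sigma_1',X,\epsilon)}=\sup_{\bar X}\frac{|v(\tau)|}{|\tau|}\exp(-\frac{\sigma_1'}{|\epsilon|}|\tau|)$ (used for $X=S_{d_p}\cup D(0,r)$ and $X=RH_k$ below). Sectors. $\iota\ge2$; $S_{d_p}\subset\mathbb C_+$, $0\le p\le\iota-1$, are unbounded open sectors centered at $0$ with bisecting directions $d_p$, $d_p<d_{p+1}$, $S_{d_p}\cap S_{d_{p+1}}=\emptyset$;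 $r>0$ is such that no root of $P$ lies in $\bar S_{d_p}\cup\bar D(0,r)$ and $D(0,r)\cap\{\mathrm{Re}(z)\le0\}\subset J_0$. $\mathcal T$ is a bounded open sector centered at $0$ with bisecting direction $0$. $\mathcal E_{HJ_n}^k$ and $\mathcal E_{S_{d_p}}$ are open sectors centered at $0$ inside $D(0,\epsilon_0)$: each $\mathcal E_{HJ_n}^k$ has aperture $<\pi$ and, for some small $\delta_{HJ_n}>0$, $\pi-\arg(t)-\arg(\epsilon)\in(-\frac\pi2+\delta_{HJ_n},\frac\pi2-\delta_{HJ_n})$ for all $\epsilon\in\mathcal E_{HJ_n}^k$, $t\in\mathcal T$; for all $t\in\mathcal T$, $\epsilon\in\mathcal E_{S_{d_p}}$ there is a direction $\gamma_{d_p}$ (depending on $t,\epsilon$) with $e^{\sqrt{-1}\gamma_{d_p}}\in S_{d_p}$ and $\gamma_{d_p}-\arg(t)-\arg(\epsilon)\in(-\frac\pi2+\eta,\frac\pi2-\eta)$, $\eta>0$ close to $0$. Good covering: $\mathcal E_{HJ_n}^k\cap\mathcal E_{HJ_n}^{k+1}\ne\emptyset$ ($-n\le k\le n-1$), $\mathcal E_{S_{d_{p+1}}}\cap\mathcal E_{S_{d_p}}\ne\emptyset$ ($0\le p\le\iota-2$), $\mathcal E_{HJ_n}^{-n}\cap\mathcal E_{S_{d_0}}\ne\emptyset$, $\mathcal E_{HJ_n}^n\cap\mathcal E_{S_{d_{\iota-1}}}\ne\emptyset$; the union of all sectors is $\mathcal U\setminus\{0\}$ for a neighborhood $\mathcal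 U$ of $0$; any three of them have empty intersection. $\epsilon_0$ is taken small enough. Paths. $P_k$ is the union of the segment from $0$ to $A_k\in H_k$ and the half-line $\{A_k-s:s\ge0\}$, with $|\mathrm{Re}(A_k)|$ so large that $\arg(A_k)-\arg(\epsilon)-\arg(t)\in(-\frac\pi2+\eta_k,\frac\pi2-\eta_k)$ for some small $\eta_k>0$, for all $\epsilon\in\mathcal E_{HJ_n}^k$, $t\in\mathcal T$; $L_{\gamma_{d_p}}=\mathbb R_+e^{\sqrt{-1}\gamma_{d_p}}$. For $\mathcal E=\mathcal E_{HJ_n}^k$ put $\Gamma_{\mathcal E}=P_k$, for $\mathcal E=\mathcal E_{S_{d_p}}$ put $\Gamma_{\mathcal E}=L_{\gamma_{d_p}}$. The functions $\varphi_{j,\mathcal{E}}$ and $u_{\mathcal{E}}$. For $0\le j\le S-1$, $w_j(\tau,\epsilon)$ is holomorphic on $\mathring{HJ}_n\times\dot D(0,\epsilon_0)$, continuous on $HJ_n\times\dot D(0,\epsilon_0)$, holomorphic on $(S_{d_p}\cup D(0,r))\times\dot D(0,\epsilon_0)$, continuous on $(\bar S_{d_p}\cup\bar D(0,r))\times\dot D(0,\epsilon_0)$ for all $p$, its restrictions to $\mathring{HJ}_n$ and $S_{d_p}$ being analytic continuations in $\tau$ of a common function on $D(0,r)$. For suitable constants $I,\delta>0$ (independent of $\epsilon$, $\delta$ close enough to $0$) it is assumed that for all $0\le h\le S-1$, $\epsilon\in\dot D(0,\epsilon_0)$, $k$, $p$, the sums $\sum_{j=0}^{S-1-h}\|w_{j+h}\|\delta^j/j!$,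 with $\|\cdot\|$ any of $\|\cdot\|_{(0,\underline\sigma',H_k,\epsilon)}$, $\|\cdot\|_{(0,\underline\varsigma',J_k,\epsilon)}$, $\|\cdot\|_{(0,\sigma_1',S_{d_p}\cup D(0,r),\epsilon)}$, are $\le I$. Put $\varphi_{j,\mathcal E}(t,\epsilon)=\int_{\Gamma_{\mathcal E}}w_j(u,\epsilon)e^{-u/(\epsilon t)}\frac{du}u$. Let $w=\sum_{\beta\ge0}w_\beta(\tau,\epsilon)z^\beta/\beta!$ be the unique formal solution of $$\partial_z^Sw=\sum_{\underline k\in\mathcal A}\frac{c_{\underline k}(z,\epsilon)}{P(\tau)}\epsilon^{-k_0}\tau^{k_0}e^{-k_2\tau}\partial_z^{k_1}w,\qquad(\partial_z^jw)(\tau,0,\epsilon)=w_j(\tau,\epsilon),\ 0\le j\le S-1,$$ for $\tau\in HJ_n$ or $\tau\in\bar S_{d_p}\cup\bar D(0,r)$. For some $0<\delta_1<1$ and small $r_{\mathcal T}>0$ it converges for $|z|<\delta\delta_1$, and $u_{\mathcal E}(t,z,\epsilon)=\int_{\Gamma_{\mathcal E}}w(u,z,\epsilon)e^{-u/(\epsilon t)}\frac{du}u$ is the resulting bounded holomorphic solution of (E1) with $(\partial_z^ju_{\mathcal E})(t,0,\epsilon)=\varphi_{j,\mathcal E}(t,\epsilon)$ on $(\mathcal T\cap D(0,r_{\mathcal T}))\times D(0,\delta\delta_1)\times\mathcal E$. Second problem. $\mathcal B\subset\mathbb N^3$ is finite; for $\underline l=(l_0,l_1,l_2)\in\mathcal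 B$, $d_{\underline l}(z,\epsilon)$ is bounded holomorphic on $D(0,\rho)\times D(0,\epsilon_0)$; $S_{\mathcal B}\ge1$ is an integer; $P_{\mathcal B}$ is a complex polynomial, not identically $0$, either constant or with all roots in $\mathbb C_+$ and outside all the sets $\bar S_{d_p}\cup\bar D(0,r)$. For all $\underline l\in\mathcal B$ (same $b$): $S_{\mathcal B}\ge b(l_0-l_1)+l_2$, $S_{\mathcal B}>l_2$, $l_1\ge1$, and $l_0-2l_1\ge1$. For each $k$, $\upsilon_k<0$ satisfies $\upsilon_k<\mathrm{Re}(A_k)$; $RH_k=H_k\cup R$ with $R=\{\upsilon_k\le\mathrm{Re}(z)\le0,\,0\le\mathrm{Im}(z)\le b_k\}$ if $a_k>0$, $R=\{\upsilon_k\le\mathrm{Re}(z)\le0,\,a_k\le\mathrm{Im}(z)\le0\}$ if $a_k<0$; $RJ_k$ is defined likewise from $J_k$ with $(c_k,d_k)$ in place of $(a_k,b_k)$. For $0\le j\le S_{\mathcal B}-1$, $\tau\mapsto v_j(\tau,\epsilon)$ is holomorphic on $D(0,r)$, on each $S_{d_p}$ and on $\mathring{HJ}_n$, continuous on $RH_k$, $RJ_k$, $\bar S_{d_p}\cup\bar D(0,r)$, depends analytically on $\epsilon\in\dot D(0,\epsilon_0)$, and $\|v_j\|_{(0,\sigma_1',RH_k,\epsilon)}$, $\|v_j\|_{(0,\underline\varsigma',RJ_k,\epsilon)}$, $\|v_j\|_{(0,\sigma_1',S_{d_p}\cup D(0,r),\epsilon)}$ are bounded by a constant independent of $\epsilon$,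 for all $k,p$. Put $\psi_{j,\mathcal E}(t,\epsilon)=\int_{\Gamma_{\mathcal E}}v_j(u,\epsilon)e^{-u/(\epsilon t)}\frac{du}u$. The functions $y_{\mathcal E}$. $y_{\mathcal E}$ is the bounded holomorphic solution, on $(\mathcal T\cap D(0,r_{\mathcal T}))\times D(0,\delta\delta_1)\times\mathcal E$, of $$P_{\mathcal B}(\epsilon t^2\partial_t)\partial_z^{S_{\mathcal B}}y=\sum_{\underline l\in\mathcal B}d_{\underline l}(z,\epsilon)t^{l_0}\partial_t^{l_1}\partial_z^{l_2}y+u_{\mathcal E}(t,z,\epsilon),\qquad(\partial_z^jy)(t,0,\epsilon)=\psi_{j,\mathcal E}(t,\epsilon),\ 0\le j\le S_{\mathcal B}-1,$$ given as a Laplace transform $y_{\mathcal E}=\int_{\Gamma_{\mathcal E}}v(u,z,\epsilon)e^{-u/(\epsilon t)}\frac{du}u$. Here, with $d_{l_0,l_1}=l_0-2l_1$, $v$ is the power series in $z$ (converging for $|z|<\delta\delta_1$), with $\tau\in HJ_n$ for $\mathcal E=\mathcal E_{HJ_n}^k$ and $\tau\in\bar S_{d_p}\cup\bar D(0,r)$ for $\mathcal E=\mathcal E_{S_{d_p}}$, solving $(\partial_z^jv)(\tau,0,\epsilon)=v_j(\tau,\epsilon)$, $0\le j\le S_{\mathcal B}-1$, and $$\partial_z^{S_{\mathcal B}}v=\sum_{\underline l\in\mathcal B}\frac{d_{\underline l}(z,\epsilon)}{P_{\mathcal B}(\tau)}\left\{\frac{\epsilon^{l_1-l_0}\tau}{\Gamma(d_{l_0,l_1})}\int_0^\tau(\tau-s)^{d_{l_0,l_1}-1}s^{l_1}\partial_z^{l_2}v(s,z,\epsilon)\frac{ds}s+\sum_{1\le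 p\le l_1-1}\frac{A_{l_1,p}\epsilon^{l_1-l_0}\tau}{\Gamma(d_{l_0,l_1}+l_1-p)}\int_0^\tau(\tau-s)^{d_{l_0,l_1}+l_1-p-1}s^p\partial_z^{l_2}v(s,z,\epsilon)\frac{ds}s\right\}+w,$$ integrals being along paths inside the domain, and $A_{l_1,p}$ being the real numbers with $t^{2l_1}\partial_t^{l_1}=(t^2\partial_t)^{l_1}+\sum_{1\le p\le l_1-1}A_{l_1,p}t^{l_1-p}(t^2\partial_t)^p$. *)

theory Defs
  imports "HOL-Complex_Analysis.Complex_Analysis"
begin

text \<open>Holomorphy on an open set of \<open>\<complex>\<^sup>2\<close> or \<open>\<complex>\<^sup>3\<close> is continuity together with holomorphy
  in each variable separately.\<close>

definition holo2 :: "(complex \<Rightarrow> complex \<Rightarrow> complex) \<Rightarrow> (complex \<times> complex) set \<Rightarrow> bool" where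
  "holo2 f U \<longleftrightarrow> continuous_on U (\<lambda>(x, e). f x e) \<and>
     (\<forall>e. (\<lambda>x. f x e) holomorphic_on {x. (x, e) \<in> U}) \<and>
     (\<forall>x. (\<lambda>e. f x e) holomorphic_on {e. (x, e) \<in> U})"

type_synonym fn3 = "complex \<Rightarrow> complex \<Rightarrow> complex \<Rightarrow> complex"

definition holo3 :: "fn3 \<Rightarrow> (complex \<times> complex \<times> complex) set \<Rightarrow> bool" where
  "holo3 f U \<longleftrightarrow> continuous_on U (\<lambda>(t, z, e). f t z e) \<and>
     (\<forall>z e. (\<lambda>t. f t z e) holomorphic_on {t. (t, z, e) \<in> U}) \<and>
     (\<forall>t e. (\<lambda>z. f t z e) holomorphic_on {z. (t, z, e) \<in> U}) \<and>
     (\<forall>t z. (\<lambda>e. f t z e) holomorphic_on {e. (t, z, e) \<in> U})"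

definition Dt :: "fn3 \<Rightarrow> fn3" where
  "Dt f = (\<lambda>t z e. deriv (\<lambda>s. f s z e) t)"

definition Dz :: "fn3 \<Rightarrow> fn3" where
  "Dz f = (\<lambda>t z e. deriv (\<lambda>x. f t x e) z)"

definition t2Dt :: "fn3 \<Rightarrow> fn3" where
  "t2Dt f = (\<lambda>t z e. t\<^sup>2 * Dt f t z e)"

definition et2Dt :: "fn3 \<Rightarrow> fn3" where
  "et2Dt f = (\<lambda>t z e. e * t\<^sup>2 * Dt f t z e)"

definition poly_et2Dt :: "complex poly \<Rightarrow> fn3 \<Rightarrow> fn3" where
  "poly_et2Dt P f = (\<lambda>t z e. \<Sum>i\<le>degree P. coeff P i * (et2Dt ^^ i) f t z e)"

definition moebius_op :: "nat \<Rightarrow> fn3 \<Rightarrow> fn3" where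
  "moebius_op k f = (\<lambda>t z e. f (t / (1 + of_nat k * e * t)) z e)"

definition op_P1 :: "(nat \<times> nat \<times> nat) set \<Rightarrow> (nat \<times> nat \<times> nat \<Rightarrow> complex \<Rightarrow> complex \<Rightarrow> complex)
    \<Rightarrow> complex poly \<Rightarrow> nat \<Rightarrow> fn3 \<Rightarrow> fn3" where
  "op_P1 A c P S f = (\<lambda>t z e. poly_et2Dt P ((Dz ^^ S) f) t z e -
     (\<Sum>(k0, k1, k2)\<in>A. c (k0, k1, k2) z e * moebius_op k2 ((t2Dt ^^ k0) ((Dz ^^ k1) f)) t z e))"

definition op_P2 :: "(nat \<times> nat \<times> nat) set \<Rightarrow> (nat \<times> nat \<times> nat \<Rightarrow> complex \<Rightarrow> complex \<Rightarrow> complex)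
    \<Rightarrow> complex poly \<Rightarrow> nat \<Rightarrow> fn3 \<Rightarrow> fn3" where
  "op_P2 B d PB SB f = (\<lambda>t z e. poly_et2Dt PB ((Dz ^^ SB) f) t z e -
     (\<Sum>(l0, l1, l2)\<in>B. d (l0, l1, l2) z e * t ^ l0 * (Dt ^^ l1) ((Dz ^^ l2) f) t z e))"

text \<open>For a function whose domain contains the set \<open>W\<close>, this says that all the shifted points
  at which \<open>op_P1 A\<close> evaluates it exist and lie in \<open>W\<close>.\<close>

definition moebius_ok :: "(nat \<times> nat \<times> nat) set \<Rightarrow> (complex \<times> complex \<times> complex) set
    \<Rightarrow> complex \<Rightarrow> complex \<Rightarrow> complex \<Rightarrow> bool" where
  "moebius_ok A W t z e \<longleftrightarrow> (\<forall>(k0, k1, k2)\<in>A.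
     1 + of_nat k2 * e * t \<noteq> 0 \<and> (t / (1 + of_nat k2 * e * t), z, e) \<in> W)"

definition strip :: "real \<Rightarrow> real \<Rightarrow> complex set" where
  "strip lo hi = {z. lo \<le> Im z \<and> Im z \<le> hi \<and> Re z \<le> 0}"

definition rstrip :: "real \<Rightarrow> real \<Rightarrow> real \<Rightarrow> complex set" where
  "rstrip lo hi \<upsilon> = strip lo hi \<union>
     (if lo > 0 then {z. \<upsilon> \<le> Re z \<and> Re z \<le> 0 \<and> 0 \<le> Im z \<and> Im z \<le> hi}
      else {z. \<upsilon> \<le> Re z \<and> Re z \<le> 0 \<and> lo \<le> Im z \<and> Im z \<le> 0})"

text \<open>Open sectors centered at the origin with bisecting direction \<open>\<theta>\<close> and aperture \<open>2 \<alpha>\<close>.\<close>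

definition usector :: "real \<Rightarrow> real \<Rightarrow> complex set" where
  "usector \<theta> \<alpha> = {of_real x * cis \<phi> | x \<phi>. 0 < x \<and> \<bar>\<phi> - \<theta>\<bar> < \<alpha>}"

definition bsector :: "real \<Rightarrow> real \<Rightarrow> real \<Rightarrow> complex set" where
  "bsector \<theta> \<alpha> R = {of_real x * cis \<phi> | x \<phi>. 0 < x \<and> x < R \<and> \<bar>\<phi> - \<theta>\<bar> < \<alpha>}"

text \<open>Membership of an angle in \<open>(-\<pi>/2 + \<eta>, \<pi>/2 - \<eta>)\<close>. Angles are taken modulo \<open>2 \<pi>\<close>, since
  they are built from arguments of points of arbitrary sectors.\<close>

definition angle_in :: "real \<Rightarrow> real \<Rightarrow> bool" where
  "angle_in \<eta> x \<longleftrightarrow> (\<exists>m::int. x + 2 * pi * of_int m \<in> {- pi / 2 + \<eta> <..< pi / 2 - \<eta>})"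

definition wnorm :: "(real \<Rightarrow> real) \<Rightarrow> complex set \<Rightarrow> (complex \<Rightarrow> complex) \<Rightarrow> ennreal" where
  "wnorm h X v = (SUP \<tau>\<in>X - {0}. ennreal (cmod (v \<tau>) / cmod \<tau> * exp (h (cmod \<tau>))))"

definition normH :: "real \<Rightarrow> real \<Rightarrow> real \<Rightarrow> real \<Rightarrow> complex set \<Rightarrow> complex
    \<Rightarrow> (complex \<Rightarrow> complex) \<Rightarrow> ennreal" where
  "normH M \<sigma>1 \<sigma>2 \<sigma>3 X e = wnorm (\<lambda>x. - (\<sigma>1 / cmod e) * x + \<sigma>2 * (M - 1) * exp (\<sigma>3 * x)) X"

definition normJ :: "real \<Rightarrow> real \<Rightarrow> real \<Rightarrow> complex set \<Rightarrow> complex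
    \<Rightarrow> (complex \<Rightarrow> complex) \<Rightarrow> ennreal" where
  "normJ \<sigma>1 \<sigma>2 \<sigma>3 X e = wnorm (\<lambda>x. - (\<sigma>1 / cmod e) * x - \<sigma>2 * exp (\<sigma>3 * x)) X"

definition normS :: "real \<Rightarrow> complex set \<Rightarrow> complex \<Rightarrow> (complex \<Rightarrow> complex) \<Rightarrow> ennreal" where
  "normS \<sigma>1 X e = wnorm (\<lambda>x. - (\<sigma>1 / cmod e) * x) (closure X)"

datatype sector_index = HJ int | SD nat

definition sector_indices :: "nat \<Rightarrow> nat \<Rightarrow> sector_index set" where
  "sector_indices n \<iota> = HJ ` {- int n..int n} \<union> SD ` {..<\<iota>}"

text \<open>Integral along the segment from \<open>0\<close> to \<open>a\<close> followed by the half-line \<open>{a + x \<zeta>. x \<ge> 0}\<close>.\<close>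

definition broken_ray_integral :: "complex \<Rightarrow> complex \<Rightarrow> (complex \<Rightarrow> complex) \<Rightarrow> complex" where
  "broken_ray_integral a \<zeta> g = contour_integral (linepath 0 a) g +
     (LBINT x:{0<..}. \<zeta> * g (a + of_real x * \<zeta>))"

text \<open>\<open>Ak k\<close> is the corner of the path \<open>P\<^sub>k\<close>; \<open>\<gamma> p t e\<close> is the direction of the half-line used
  in the \<open>p\<close>-th unbounded sector.\<close>

definition laplace :: "(int \<Rightarrow> complex) \<Rightarrow> (nat \<Rightarrow> complex \<Rightarrow> complex \<Rightarrow> real) \<Rightarrow> sector_index
    \<Rightarrow> (complex \<Rightarrow> complex) \<Rightarrow> complex \<Rightarrow> complex \<Rightarrow> complex" where
  "laplace Ak \<gamma> i f t e =
     (let g = (\<lambda>\<tau>. f \<tau> * exp (- \<tau> / (e * t)) / \<tau>) in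
      case i of HJ k \<Rightarrow> broken_ray_integral (Ak k) (- 1) g
              | SD p \<Rightarrow> broken_ray_integral 0 (cis (\<gamma> p t e)) g)"

text \<open>The domain \<open>(T \<inter> D(0, r\<^sub>T)) \<times> D(0, R) \<times> E\<close>.\<close>

definition sol_dom :: "complex set \<Rightarrow> real \<Rightarrow> real \<Rightarrow> complex set
    \<Rightarrow> (complex \<times> complex \<times> complex) set" where
  "sol_dom T rT R E = (T \<inter> ball 0 rT) \<times> ball 0 R \<times> E"

end

theory Submission
  imports Defs
begin

text \<open>Put \<open>f = \<P>\<^sub>2 y\<close>. On the sectorial domain the equation for \<open>y\<close> says \<open>f = u\<close>. Since \<open>f\<close> is
  again holomorphic and the slices in \<open>t\<close> of the larger domain \<open>W\<close> are connected, the identity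
  theorem gives \<open>f = u\<close> on all of \<open>W\<close>, in particular at the points reached by the Moebius maps;
  hence \<open>\<P>\<^sub>1 f = \<P>\<^sub>1 u = 0\<close>, and the constraints on \<open>f\<close> are the initial conditions of \<open>u\<close>.
  The form of the coefficients follows because differential operators with coefficients polynomial in
  \<open>t\<close> and holomorphic in \<open>(z, \<epsilon>)\<close> are closed under composition with \<open>\<partial>\<^sub>t\<close> and \<open>\<partial>\<^sub>z\<close>, and the
  coefficients of \<open>\<P>\<^sub>1\<close> are unaffected by Moebius maps, as they do not depend on \<open>t\<close>.\<close>

section \<open>Partial derivatives in two variables\<close>

text \<open>This is Cauchy's formula for the first derivative with the circle parametrised over
  \<open>{0..1}\<close> and the factor 2 pi i cancelled. Over this fixed interval, a parameter in
  \<open>h\<close> or the point \<open>x\<close> enters only through the integrand, so theorems on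
  parameter integrals apply.\<close>

lemma deriv_circle_integral:
  assumes h: "h holomorphic_on X" "open X" and X: "cball a r \<subseteq> X" and x: "x \<in> ball a r"
  shows "deriv h x = integral {0..1} (\<lambda>s. h (circlepath a r s) / (circlepath a r s - x)\<^sup>2 *
           (of_real r * exp (2 * of_real pi * \<i> * of_real s)))"
proof -
  have "((\<lambda>u. h u / (u - x) ^ Suc 1) has_contour_integral 2 * pi * \<i> / fact 1 * (deriv ^^ 1) h x)
      (circlepath a r)"
    using X h x by (intro Cauchy_has_contour_integral_higher_derivative_circlepath)
      (meson holomorphic_on_subset holomorphic_on_imp_continuous_on ball_subset_cball order_trans)+
  from contour_integral_unique[OF this] have "2 * pi * \<i> * deriv h x = integral {0..1}
      (\<lambda>s. h (circlepath a r s) / (circlepath a r s - x)\<^sup>2 * (2 * pi * \<i> * r * exp (2 * of_real pi * \<i> * s)))"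
    by (simp add: contour_integral_integral vector_derivative_circlepath power2_eq_square)
  also have "\<dots> = integral {0..1} (\<lambda>s. 2 * pi * \<i> *
      (h (circlepath a r s) / (circlepath a r s - x)\<^sup>2 * (r * exp (2 * of_real pi * \<i> * s))))"
    by (intro integral_cong) (simp add: mult_ac)
  also have "\<dots> = 2 * pi * \<i> * integral {0..1}
      (\<lambda>s. h (circlepath a r s) / (circlepath a r s - x)\<^sup>2 * (r * exp (2 * of_real pi * \<i> * s)))"
    by (rule integral_mult_right)
  finally show ?thesis by simp
qed

text \<open>The closed ball in the first factor holds the circle of integration; the open ball in
  the second is where the parameter varies.\<close>

lemma open_prod_cball_nbhd:
  fixes a :: "'a::metric_space" and p :: "'p::metric_space"
  assumes "open U" "(a, p) \<in> U"
  obtains r where "r > 0" "cball a r \<times> ball p r \<subseteq> U"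
proof -
  obtain X Y where XY: "open X" "open Y" "a \<in> X" "p \<in> Y" "X \<times> Y \<subseteq> U"
    using assms by (auto elim: open_prod_elim)
  obtain r1 where r1: "r1 > 0" "cball a r1 \<subseteq> X" using XY by (meson open_contains_cball)
  obtain r2 where r2: "r2 > 0" "cball p r2 \<subseteq> Y" using XY by (meson open_contains_cball)
  show ?thesis
  proof
    show "min r1 r2 > 0" using r1 r2 by auto
    show "cball a (min r1 r2) \<times> ball p (min r1 r2) \<subseteq> U" using r1 r2 XY(5) by fastforce
  qed
qed

lemma circlepath_in_cball: "r \<ge> 0 \<Longrightarrow> circlepath a r s \<in> cball a r"
  by (simp add: circlepath dist_norm norm_mult)

lemma circlepath_neq_ball: "x \<in> ball a r \<Longrightarrow> circlepath a r s \<noteq> x"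
  by (auto simp: circlepath dist_norm norm_mult)

lemma continuous_on_circlepath [continuous_intros]:
  "continuous_on X f \<Longrightarrow> continuous_on X (\<lambda>x. circlepath a r (f x))"
  unfolding circlepath by (intro continuous_intros)

text \<open>Near each point the derivative is a Cauchy integral over one fixed circle, whose
  integrand is jointly continuous. The parameter lives in an arbitrary metric space, so that it can
  later be the pair \<open>(z, e)\<close>.\<close>

lemma continuous_on_partial_deriv:
  fixes g :: "complex \<Rightarrow> 'p::metric_space \<Rightarrow> complex"
  assumes U: "open U" and cont: "continuous_on U (\<lambda>(x, p). g x p)"
    and hol: "\<And>p. (\<lambda>x. g x p) holomorphic_on {x. (x, p) \<in> U}"
  shows "continuous_on U (\<lambda>(x, p). deriv (\<lambda>x. g x p) x)"
  unfolding continuous_on_eq_continuous_at[OF U]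
proof (safe)
  fix a p assume ap: "(a, p) \<in> U"
  obtain r where r: "r > 0" "cball a r \<times> ball p r \<subseteq> U"
    using open_prod_cball_nbhd[OF U ap] by blast
  let ?N = "ball a r \<times> ball p r"
  let ?G = "\<lambda>(x, q) s. g (circlepath a r s) q / (circlepath a r s - x)\<^sup>2 *
           (of_real r * exp (2 * of_real pi * \<i> * of_real s))"
  have slice: "open {x. (x, q) \<in> U}" for q
    using open_vimage[OF U, of "\<lambda>x. (x, q)"] by (simp add: vimage_def continuous_intros)
  have eq: "deriv (\<lambda>x. g x q) x = integral {0..1} (?G (x, q))" if "(x, q) \<in> ?N" for x q
  proof -
    have "cball a r \<subseteq> {x. (x, q) \<in> U}" using that r by auto
    from deriv_circle_integral[OF hol slice this, of x] that show ?thesis by simp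
  qed
  have contg: "continuous_on (?N \<times> cbox 0 1) (\<lambda>y. g (circlepath a r (snd y)) (snd (fst y)))"
  proof -
    have "continuous_on (?N \<times> cbox 0 1) (\<lambda>y. (\<lambda>(x, p). g x p) (circlepath a r (snd y), snd (fst y)))"
      by (rule continuous_on_compose2[OF cont])
        (use r circlepath_in_cball[of r a] in \<open>auto intro!: continuous_intros\<close>)
    then show ?thesis by simp
  qed
  have "continuous_on (?N \<times> cbox 0 1) (\<lambda>y. g (circlepath a r (snd y)) (snd (fst y)) / (circlepath a r (snd y) - fst (fst y))\<^sup>2 *
           (of_real r * exp (2 * of_real pi * \<i> * of_real (snd y))))"
    by (intro continuous_intros contg) (use circlepath_neq_ball in auto)
  then have "continuous_on (?N \<times> cbox 0 1) (\<lambda>(y, s). ?G y s)"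
    by (simp add: case_prod_unfold)
  then have "continuous_on ?N (\<lambda>y. integral {0..1} (?G y))"
    using integral_continuous_on_param by fastforce
  then have "continuous_on ?N (\<lambda>(x, q). deriv (\<lambda>x. g x q) x)"
    by (rule continuous_on_eq) (use eq in auto)
  moreover have "open ?N" "(a, p) \<in> ?N" using r by (auto intro: open_Times)
  ultimately show "isCont (\<lambda>(x, q). deriv (\<lambda>x. g x q) x) (a, p)"
    by (simp add: continuous_on_eq_continuous_at)
qed

lemma open_slices:
  assumes "open U"
  shows "open {x. (x, p) \<in> U}" "open {p. (x, p) \<in> U}"
  using open_vimage[OF assms, of "\<lambda>x. (x, p)"] open_vimage[OF assms, of "\<lambda>p. (x, p)"]
  by (simp_all add: vimage_def continuous_intros)

lemma open_prod_swap: "open U \<Longrightarrow> open {(y, x). (x, y) \<in> U}"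
  using open_vimage[of U "\<lambda>p. (snd p, fst p)"]
  by (simp add: vimage_def case_prod_unfold continuous_intros)

lemma holo2_swap: 
  assumes "holo2 g U" shows "holo2 (\<lambda>y x. g x y) {(y, x). (x, y) \<in> U}"
proof -
  have "continuous_on {(y, x). (x, y) \<in> U} (\<lambda>p. (\<lambda>(x, e). g x e) (snd p, fst p))"
    by (rule continuous_on_compose2[of U]) (use assms in \<open>auto simp: holo2_def intro!: continuous_intros\<close>)
  then show ?thesis using assms unfolding holo2_def by (simp add: split_beta)
qed

text \<open>The Cauchy integral for the \<open>x\<close>-derivative is differentiated in
  \<open>y\<close> under the integral sign. The value is kept explicit because it is again a Cauchy
  integral, now of \<open>deriv (g x) b\<close>; the inclusion of the closed disc allows it to be
  read that way.\<close>

lemma holo2_has_field_derivative_deriv: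
  assumes U: "open U" and g: "holo2 g U" and xy: "(a, b) \<in> U"
  obtains r where "r > 0" and "((\<lambda>y. deriv (\<lambda>x. g x y) a) has_field_derivative
     integral {0..1} (\<lambda>s. deriv (g (circlepath a r s)) b / (circlepath a r s - a)\<^sup>2 *
           (of_real r * exp (2 * of_real pi * \<i> * of_real s)))) (at b)"
    and "cball a r \<subseteq> {x. (x, b) \<in> U}"
proof -
  obtain r where r: "r > 0" "cball a r \<times> ball b r \<subseteq> U"
    using open_prod_cball_nbhd[OF U xy] by blast
  \<comment> \<open>This is the Cauchy kernel at the centre \<open>a\<close>. It is independent of
    \<open>y\<close>, so only the factor \<open>g\<close> has to be differentiated.\<close>
  let ?K = "\<lambda>s. of_real r * exp (2 * of_real pi * \<i> * of_real s) / (circlepath a r s - a)\<^sup>2"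
  let ?I = "\<lambda>y. integral (cbox 0 1) (\<lambda>s. g (circlepath a r s) y * ?K s)"
  have nz: "circlepath a r s - a \<noteq> 0" for s using circlepath_neq_ball[of a a r] r by auto
  have mem: "(circlepath a r s, y) \<in> U" if "y \<in> ball b r" for s y
    using circlepath_in_cball[of r a s] r that by auto
  have eq: "deriv (\<lambda>x. g x y) a = ?I y" if "y \<in> ball b r" for y
  proof -
    have "cball a r \<subseteq> {x. (x, y) \<in> U}" using that r by auto
    moreover have "(\<lambda>x. g x y) holomorphic_on {x. (x, y) \<in> U}" using g by (simp add: holo2_def)
    ultimately show ?thesis
      using deriv_circle_integral[of "\<lambda>x. g x y" "{x. (x, y) \<in> U}" a r a] r open_slices(1)[OF U, of y]
      by simp
  qed
  have contK: "continuous_on X (\<lambda>y. ?K (f y))" if "continuous_on X f" for X and f :: "'t::topological_space \<Rightarrow> real"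
    by (intro continuous_intros that) (use nz in auto)
  \<comment> \<open>The Leibniz rule asks for joint continuity of the \<open>y\<close>-derivative;
    exchanging the variables reduces this to the continuity already known for the first
    variable.\<close>
  have contg': "continuous_on U (\<lambda>(x, y). deriv (g x) y)"
  proof -
    let ?V = "{(y, x). (x, y) \<in> U}"
    have "continuous_on ?V (\<lambda>(y, x). deriv (\<lambda>y. g x y) y)"
      using holo2_swap[OF g] by (intro continuous_on_partial_deriv open_prod_swap U) (auto simp: holo2_def)
    then have "continuous_on U (\<lambda>p. (\<lambda>(y, x). deriv (\<lambda>y. g x y) y) (snd p, fst p))"
      by (rule continuous_on_compose2) (auto intro!: continuous_intros)
    then show ?thesis by (simp add: case_prod_unfold)
  qed
  have cont1: "continuous_on (ball b r \<times> cbox 0 1) (\<lambda>(y, s). deriv (g (circlepath a r s)) y * ?K s)"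
  proof -
    have "continuous_on (ball b r \<times> cbox 0 1) (\<lambda>p. (\<lambda>(x, y). deriv (g x) y) (circlepath a r (snd p), fst p))"
      by (rule continuous_on_compose2[OF contg']) (use mem in \<open>auto intro!: continuous_intros\<close>)
    from continuous_on_mult[OF this contK[of _ snd]] show ?thesis
      by (simp add: case_prod_unfold continuous_on_snd)
  qed
  have cont0: "continuous_on (cbox 0 1) (\<lambda>s. g (circlepath a r s) y * ?K s)" if "y \<in> ball b r" for y
  proof -
    have "continuous_on (cbox 0 1) (\<lambda>s. (\<lambda>(x, y). g x y) (circlepath a r s, y))"
      by (rule continuous_on_compose2[of U])
        (use mem that g in \<open>auto simp: holo2_def intro!: continuous_intros\<close>)
    from continuous_on_mult[OF this contK[of _ "\<lambda>s. s"]] show ?thesis by simp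
  qed
  have "(?I has_field_derivative integral (cbox 0 1) (\<lambda>s. deriv (g (circlepath a r s)) b * ?K s)) (at b within ball b r)"
  proof (rule leibniz_rule_field_derivative[OF _ _ cont1])
    fix y and s :: real assume y: "y \<in> ball b r"
    have "g (circlepath a r s) holomorphic_on {y. (circlepath a r s, y) \<in> U}"
      using g by (auto simp: holo2_def)
    then have "(g (circlepath a r s) has_field_derivative deriv (g (circlepath a r s)) y) (at y)"
      using open_slices[OF U] mem[OF y] holomorphic_derivI by blast
    then show "((\<lambda>y. g (circlepath a r s) y * ?K s) has_field_derivative deriv (g (circlepath a r s)) y * ?K s)
       (at y within ball b r)"
      by (rule DERIV_cmult_right[OF has_field_derivative_at_within])
    show "(\<lambda>s. g (circlepath a r s) y * ?K s) integrable_on cbox 0 1"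
      by (rule integrable_continuous[OF cont0[OF y]])
  qed (use r in auto)
  then have "(?I has_field_derivative integral (cbox 0 1) (\<lambda>s. deriv (g (circlepath a r s)) b * ?K s)) (at b)"
    using r by (simp add: at_within_open[OF _ open_ball])
  then have "((\<lambda>y. deriv (\<lambda>x. g x y) a) has_field_derivative
     integral (cbox 0 1) (\<lambda>s. deriv (g (circlepath a r s)) b * ?K s)) (at b)"
    by (rule has_field_derivative_transform_within_open[of _ _ _ "ball b r"]) (use eq r(1) in simp_all)
  moreover have "cball a r \<subseteq> {x. (x, b) \<in> U}" using r by auto
  ultimately show ?thesis using that[OF r(1)] by simp
qed

lemma holo2_partial_deriv:
  assumes U: "open U" and g: "holo2 g U"
  shows "holo2 (\<lambda>x y. deriv (\<lambda>x. g x y) x) U"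
  unfolding holo2_def
proof (intro conjI allI)
  show "continuous_on U (\<lambda>(x, y). deriv (\<lambda>x. g x y) x)"
    using g by (intro continuous_on_partial_deriv U) (auto simp: holo2_def)
  show "(\<lambda>x. deriv (\<lambda>x. g x y) x) holomorphic_on {x. (x, y) \<in> U}" for y
    using g open_slices[OF U] by (auto simp: holo2_def intro!: holomorphic_deriv)
  show "(\<lambda>y. deriv (\<lambda>x. g x y) x) holomorphic_on {y. (x, y) \<in> U}" for x
    unfolding holomorphic_on_open[OF open_slices(2)[OF U]]
  proof safe
    fix y assume "(x, y) \<in> U"
    from holo2_has_field_derivative_deriv[OF U g this]
    show "\<exists>f'. ((\<lambda>y. deriv (\<lambda>x. g x y) x) has_field_derivative f') (at y)"
      by blast
  qed
qed

lemma holo2_partial_deriv2: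
  assumes U: "open U" and g: "holo2 g U"
  shows "holo2 (\<lambda>x y. deriv (g x) y) U"
  using holo2_swap[OF holo2_partial_deriv[OF open_prod_swap[OF U] holo2_swap[OF g]]] by simp

text \<open>Both sides equal the same circle integral of \<open>deriv (g x) b\<close>: the left by
  differentiation under the integral, the right by Cauchy's formula.\<close>

lemma holo2_deriv_commute:
  assumes U: "open U" and g: "holo2 g U" and xy: "(a, b) \<in> U"
  shows "deriv (\<lambda>y. deriv (\<lambda>x. g x y) a) b = deriv (\<lambda>x. deriv (g x) b) a"
proof -
  obtain r where r: "r > 0"
    "((\<lambda>y. deriv (\<lambda>x. g x y) a) has_field_derivative
     integral {0..1} (\<lambda>s. deriv (g (circlepath a r s)) b / (circlepath a r s - a)\<^sup>2 *
           (of_real r * exp (2 * of_real pi * \<i> * of_real s)))) (at b)"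
    "cball a r \<subseteq> {x. (x, b) \<in> U}"
    by (rule holo2_has_field_derivative_deriv[OF U g xy])
  have "(\<lambda>x. deriv (g x) b) holomorphic_on {x. (x, b) \<in> U}"
    using holo2_partial_deriv2[OF U g] by (auto simp: holo2_def)
  from deriv_circle_integral[OF this open_slices(1)[OF U] r(3), of a] r
  show ?thesis using DERIV_imp_deriv[OF r(2)] by simp
qed

section \<open>Partial derivatives in three variables\<close>

lemma holo3_subset: "holo3 f U \<Longrightarrow> V \<subseteq> U \<Longrightarrow> holo3 f V"
  unfolding holo3_def
  by (intro conjI allI; elim conjE allE)
    (erule continuous_on_subset holomorphic_on_subset; blast)+

lemma open_slices3:
  fixes U :: "(complex \<times> complex \<times> complex) set"
  assumes "open U"
  shows "open {(t, z). (t, z, e) \<in> U}" "open {(t, e). (t, z, e) \<in> U}" "open {(z, t, e). (t, z, e) \<in> U}"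
    "open {t. (t, z, e) \<in> U}" "open {z. (t, z, e) \<in> U}"
  using open_vimage[OF assms, of "\<lambda>p. (fst p, snd p, e)"] open_vimage[OF assms, of "\<lambda>p. (fst p, z, snd p)"]
    open_vimage[OF assms, of "\<lambda>p. (fst (snd p), fst p, snd (snd p))"]
    open_vimage[OF assms, of "\<lambda>t. (t, z, e)"] open_vimage[OF assms, of "\<lambda>z. (t, z, e)"]
  by (simp_all add: vimage_def case_prod_unfold continuous_intros)

lemma holo3_slice:
  assumes "holo3 f U"
  shows "holo2 (\<lambda>t z. f t z e) {(t, z). (t, z, e) \<in> U}"
    and "holo2 (\<lambda>t e. f t z e) {(t, e). (t, z, e) \<in> U}"
proof -
  have c: "continuous_on U (\<lambda>(t, z, e). f t z e)" using assms by (simp add: holo3_def)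
  have "continuous_on {(t, z). (t, z, e) \<in> U} (\<lambda>p. (\<lambda>(t, z, e). f t z e) (fst p, snd p, e))"
    by (rule continuous_on_compose2[OF c]) (auto intro!: continuous_intros)
  then show "holo2 (\<lambda>t z. f t z e) {(t, z). (t, z, e) \<in> U}"
    using assms unfolding holo2_def holo3_def by (simp add: split_beta)
  have "continuous_on {(t, e). (t, z, e) \<in> U} (\<lambda>p. (\<lambda>(t, z, e). f t z e) (fst p, z, snd p))"
    by (rule continuous_on_compose2[OF c]) (auto intro!: continuous_intros)
  then show "holo2 (\<lambda>t e. f t z e) {(t, e). (t, z, e) \<in> U}"
    using assms unfolding holo2_def holo3_def by (simp add: split_beta)
qed

text \<open>Exchanging \<open>t\<close> and \<open>z\<close> turns \<open>Dt\<close> into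
  \<open>Dz\<close>, so results on \<open>Dt\<close> need not be proved twice.\<close>

lemma holo3_swap:
  assumes "holo3 f U"
  shows "holo3 (\<lambda>z t e. f t z e) {(z, t, e). (t, z, e) \<in> U}"
proof -
  have c: "continuous_on U (\<lambda>(t, z, e). f t z e)" using assms by (simp add: holo3_def)
  have "continuous_on {(z, t, e). (t, z, e) \<in> U}
      (\<lambda>p. (\<lambda>(t, z, e). f t z e) (fst (snd p), fst p, snd (snd p)))"
    by (rule continuous_on_compose2[OF c]) (auto intro!: continuous_intros)
  then show ?thesis
    using assms unfolding holo3_def by (simp add: split_beta)
qed

text \<open>For continuity, \<open>(z, e)\<close> is treated as a single parameter. Holomorphy in
  \<open>z\<close> and in \<open>e\<close> follows from the two-variable result on the slices where
  the other one is frozen.\<close>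

lemma holo3_Dt:
  assumes U: "open U" and f: "holo3 f U"
  shows "holo3 (Dt f) U"
  unfolding holo3_def
proof (intro conjI allI)
  have "continuous_on U (\<lambda>(t, p). deriv (\<lambda>t. f t (fst p) (snd p)) t)"
    using f by (intro continuous_on_partial_deriv U) (auto simp: holo3_def split_beta)
  then show "continuous_on U (\<lambda>(t, z, e). Dt f t z e)"
    by (simp add: Dt_def split_beta)
  show "(\<lambda>t. Dt f t z e) holomorphic_on {t. (t, z, e) \<in> U}" for z e
    using f open_slices3(4)[OF U] unfolding Dt_def holo3_def by (intro holomorphic_deriv) auto
  show "(\<lambda>z. Dt f t z e) holomorphic_on {z. (t, z, e) \<in> U}" for t e
    using holo2_partial_deriv[OF open_slices3(1)[OF U] holo3_slice(1)[OF f]]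
    by (simp add: holo2_def Dt_def)
  show "(\<lambda>e. Dt f t z e) holomorphic_on {e. (t, z, e) \<in> U}" for t z
    using holo2_partial_deriv[OF open_slices3(2)[OF U] holo3_slice(2)[OF f]]
    by (simp add: holo2_def Dt_def)
qed

lemma holo3_Dz:
  assumes U: "open U" and f: "holo3 f U"
  shows "holo3 (Dz f) U"
  using holo3_swap[OF holo3_Dt[OF open_slices3(3)[OF U] holo3_swap[OF f]]]
  by (simp add: Dt_def Dz_def)

lemma holo3_Dt_Dz_power:
  assumes "open U" "holo3 f U"
  shows "holo3 ((Dt ^^ l) ((Dz ^^ m) f)) U"
proof -
  have "holo3 ((Dz ^^ m) f) U" by (induction m) (auto intro: holo3_Dz assms)
  then show ?thesis by (induction l) (auto intro: holo3_Dt assms)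
qed

lemma Dz_Dt_commute:
  assumes "open U" "holo3 f U" "(t, z, e) \<in> U"
  shows "Dz (Dt f) t z e = Dt (Dz f) t z e"
  using holo2_deriv_commute[OF open_slices3(1)[OF assms(1)] holo3_slice(1)[OF assms(2)], of t z e] assms(3)
  by (simp add: Dz_def Dt_def)

section \<open>Locality of the operators\<close>

lemma Dt_cong_open:
  assumes U: "open U" and eq: "\<And>t z e. (t, z, e) \<in> U \<Longrightarrow> f t z e = g t z e" and "(t, z, e) \<in> U"
  shows "Dt f t z e = Dt g t z e"
  unfolding Dt_def
  by (intro deriv_cong_ev refl eventually_nhds[THEN iffD2] exI[of _ "{t. (t, z, e) \<in> U}"] conjI)
    (use assms open_slices3[OF U] in auto)

lemma Dz_cong_open:
  assumes U: "open U" and eq: "\<And>t z e. (t, z, e) \<in> U \<Longrightarrow> f t z e = g t z e" and "(t, z, e) \<in> U"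
  shows "Dz f t z e = Dz g t z e"
  unfolding Dz_def
  by (intro deriv_cong_ev refl eventually_nhds[THEN iffD2] exI[of _ "{z. (t, z, e) \<in> U}"] conjI)
    (use assms open_slices3[OF U] in auto)

lemma Dz_Dt_power_commute:
  assumes U: "open U" and f: "holo3 f U" and x: "(t, z, e) \<in> U"
  shows "Dz ((Dt ^^ l) f) t z e = (Dt ^^ l) (Dz f) t z e"
  using x
proof (induction l arbitrary: t z e)
  case (Suc l)
  have "holo3 ((Dt ^^ l) f) U"
    using holo3_Dt_Dz_power[OF U f, of l 0] by simp
  then have "Dz ((Dt ^^ Suc l) f) t z e = Dt (Dz ((Dt ^^ l) f)) t z e"
    using Dz_Dt_commute[OF U _ Suc.prems] by simp
  also have "\<dots> = Dt ((Dt ^^ l) (Dz f)) t z e"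
    by (rule Dt_cong_open[OF U Suc.IH Suc.prems])
  finally show ?case by simp
qed simp

text \<open>Agreement is required on all of \<open>U\<close>, not just at a point, so that applying
  \<open>D\<close> reproduces the hypothesis and the step can be iterated.\<close>

lemma power_op_cong_open:
  fixes D :: "fn3 \<Rightarrow> fn3"
  assumes D: "\<And>f g t z e. (\<And>t z e. (t, z, e) \<in> U \<Longrightarrow> f t z e = g t z e) \<Longrightarrow> (t, z, e) \<in> U \<Longrightarrow> D f t z e = D g t z e"
    and "\<And>t z e. (t, z, e) \<in> U \<Longrightarrow> f t z e = g t z e" "(t, z, e) \<in> U"
  shows "(D ^^ k) f t z e = (D ^^ k) g t z e"
  using assms(2,3) by (induction k arbitrary: t z e) (auto intro: D)

lemma t2Dt_cong_open:
  assumes "open U" "\<And>t z e. (t, z, e) \<in> U \<Longrightarrow> f t z e = g t z e" "(t, z, e) \<in> U"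
  shows "t2Dt f t z e = t2Dt g t z e"
  using Dt_cong_open[OF assms] by (simp add: t2Dt_def)

lemma et2Dt_cong_open:
  assumes "open U" "\<And>t z e. (t, z, e) \<in> U \<Longrightarrow> f t z e = g t z e" "(t, z, e) \<in> U"
  shows "et2Dt f t z e = et2Dt g t z e"
  using Dt_cong_open[OF assms] by (simp add: et2Dt_def)

lemma Dz_power_cong_open:
  assumes "open U" "\<And>t z e. (t, z, e) \<in> U \<Longrightarrow> f t z e = g t z e" "(t, z, e) \<in> U"
  shows "(Dz ^^ k) f t z e = (Dz ^^ k) g t z e"
  by (rule power_op_cong_open[OF Dz_cong_open[OF assms(1)] assms(2,3)])

text \<open>The Moebius maps move the point, so agreement near \<open>(t, z, e)\<close> would not
  suffice; \<open>moebius_ok\<close> places the shifted points in \<open>U\<close>, where locality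
  applies again.\<close>

lemma op_P1_cong_open:
  assumes U: "open U" and eq: "\<And>t z e. (t, z, e) \<in> U \<Longrightarrow> f t z e = g t z e"
    and x: "(t, z, e) \<in> U" "moebius_ok A U t z e"
  shows "op_P1 A c P S f t z e = op_P1 A c P S g t z e"
proof -
  have Dz: "(Dz ^^ k) f t z e = (Dz ^^ k) g t z e" if "(t, z, e) \<in> U" for k t z e
    by (rule Dz_power_cong_open[OF U eq that])
  have "(et2Dt ^^ i) ((Dz ^^ S) f) t z e = (et2Dt ^^ i) ((Dz ^^ S) g) t z e" for i
    by (rule power_op_cong_open[OF et2Dt_cong_open[OF U] Dz x(1)])
  moreover have "moebius_op k2 ((t2Dt ^^ k0) ((Dz ^^ k1) f)) t z e = moebius_op k2 ((t2Dt ^^ k0) ((Dz ^^ k1) g)) t z e"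
    if "(k0, k1, k2) \<in> A" for k0 k1 k2
    unfolding moebius_op_def
    by (rule power_op_cong_open[OF t2Dt_cong_open[OF U] Dz]) (use that x in \<open>auto simp: moebius_ok_def\<close>)
  ultimately show ?thesis
    unfolding op_P1_def poly_et2Dt_def
    by (intro arg_cong2[of _ _ _ _ "(-)"] sum.cong refl) auto
qed

section \<open>Closure properties of holomorphic functions\<close>

lemma holo2_const: "holo2 (\<lambda>z e. k) U"
  by (simp add: holo2_def)

lemma holo2_snd: "holo2 (\<lambda>z e. e) U"
  by (auto simp: holo2_def split_beta intro!: continuous_intros)

lemma holo2_add: "holo2 a U \<Longrightarrow> holo2 b U \<Longrightarrow> holo2 (\<lambda>z e. a z e + b z e) U"
  by (auto simp: holo2_def split_beta intro!: continuous_intros holomorphic_intros)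

lemma holo2_mult: "holo2 a U \<Longrightarrow> holo2 b U \<Longrightarrow> holo2 (\<lambda>z e. a z e * b z e) U"
  by (auto simp: holo2_def split_beta intro!: continuous_intros holomorphic_intros)

lemma holo3_const: "holo3 (\<lambda>t z e. k) U"
  by (simp add: holo3_def)

lemma holo3_add: "holo3 f U \<Longrightarrow> holo3 g U \<Longrightarrow> holo3 (\<lambda>t z e. f t z e + g t z e) U"
  by (auto simp: holo3_def split_beta intro!: continuous_intros holomorphic_intros)

lemma holo3_mult: "holo3 f U \<Longrightarrow> holo3 g U \<Longrightarrow> holo3 (\<lambda>t z e. f t z e * g t z e) U"
  by (auto simp: holo3_def split_beta intro!: continuous_intros holomorphic_intros)

lemma holo3_power_fst: "holo3 (\<lambda>t z e. t ^ i) U"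
  by (auto simp: holo3_def split_beta intro!: continuous_intros holomorphic_intros)

lemma holo3_holo2:
  assumes a: "holo2 a \<Omega>" and U: "U \<subseteq> UNIV \<times> \<Omega>"
  shows "holo3 (\<lambda>t z e. a z e) U"
proof -
  have "continuous_on U (\<lambda>p. (\<lambda>(z, e). a z e) (snd p))"
    by (rule continuous_on_compose2[of \<Omega>]) (use a U in \<open>auto simp: holo2_def intro!: continuous_intros\<close>)
  moreover have "(\<lambda>z. a z e) holomorphic_on {z. (t, z, e) \<in> U}" for t e
    by (rule holomorphic_on_subset[of _ "{z. (z, e) \<in> \<Omega>}"]) (use a U in \<open>auto simp: holo2_def\<close>)
  moreover have "(\<lambda>e. a z e) holomorphic_on {e. (t, z, e) \<in> U}" for t z
    by (rule holomorphic_on_subset[of _ "{e. (z, e) \<in> \<Omega>}"]) (use a U in \<open>auto simp: holo2_def\<close>)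
  ultimately show ?thesis by (simp add: holo3_def split_beta)
qed

lemma holo3_transform:
  assumes g: "holo3 g U" and eq: "\<And>t z e. (t, z, e) \<in> U \<Longrightarrow> g t z e = f t z e"
  shows "holo3 f U"
  unfolding holo3_def
proof (intro conjI allI)
  show "continuous_on U (\<lambda>(t, z, e). f t z e)"
    by (rule continuous_on_eq[of _ "\<lambda>(t, z, e). g t z e"]) (use g eq in \<open>auto simp: holo3_def\<close>)
  show "(\<lambda>t. f t z e) holomorphic_on {t. (t, z, e) \<in> U}" for z e
    by (rule holomorphic_transform[of "\<lambda>t. g t z e"]) (use g eq in \<open>auto simp: holo3_def\<close>)
  show "(\<lambda>z. f t z e) holomorphic_on {z. (t, z, e) \<in> U}" for t e
    by (rule holomorphic_transform[of "\<lambda>z. g t z e"]) (use g eq in \<open>auto simp: holo3_def\<close>)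
  show "(\<lambda>e. f t z e) holomorphic_on {e. (t, z, e) \<in> U}" for t z
    by (rule holomorphic_transform[of "\<lambda>e. g t z e"]) (use g eq in \<open>auto simp: holo3_def\<close>)
qed

lemma holo3_differentiable:
  assumes "open U" "holo3 f U" "(t, z, e) \<in> U"
  shows "(\<lambda>t. f t z e) field_differentiable at t" "(\<lambda>z. f t z e) field_differentiable at z"
  using assms open_slices3[OF assms(1)] holomorphic_on_imp_differentiable_at
  by (fastforce simp: holo3_def)+

lemma Dt_add:
  assumes "open U" "holo3 f U" "holo3 g U" "(t, z, e) \<in> U"
  shows "Dt (\<lambda>t z e. f t z e + g t z e) t z e = Dt f t z e + Dt g t z e"
  unfolding Dt_def by (intro deriv_add holo3_differentiable[OF assms(1)] assms)

lemma Dz_add: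
  assumes "open U" "holo3 f U" "holo3 g U" "(t, z, e) \<in> U"
  shows "Dz (\<lambda>t z e. f t z e + g t z e) t z e = Dz f t z e + Dz g t z e"
  unfolding Dz_def by (intro deriv_add holo3_differentiable[OF assms(1)] assms)

lemma Dt_mult:
  assumes "open U" "holo3 f U" "holo3 g U" "(t, z, e) \<in> U"
  shows "Dt (\<lambda>t z e. f t z e * g t z e) t z e = f t z e * Dt g t z e + Dt f t z e * g t z e"
  unfolding Dt_def by (intro deriv_mult holo3_differentiable[OF assms(1)] assms)

lemma Dz_mult:
  assumes "open U" "holo3 f U" "holo3 g U" "(t, z, e) \<in> U"
  shows "Dz (\<lambda>t z e. f t z e * g t z e) t z e = f t z e * Dz g t z e + Dz f t z e * g t z e"
  unfolding Dz_def by (intro deriv_mult holo3_differentiable[OF assms(1)] assms)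

section \<open>Differential operators with coefficients polynomial in \<open>t\<close>\<close>

text \<open>An entry \<open>(a, i, l, m)\<close> encodes the operator \<open>a(z, \<epsilon>) t\<^sup>i \<partial>\<^sub>t\<^sup>l \<partial>\<^sub>z\<^sup>m\<close>.\<close>

type_synonym diff_monomial = "(complex \<Rightarrow> complex \<Rightarrow> complex) \<times> nat \<times> nat \<times> nat"

text \<open>A list may repeat exponents: adding operators is then appending lists, and like terms
  are collected only once, at the end.\<close>

definition diff_poly :: "diff_monomial list \<Rightarrow> fn3 \<Rightarrow> fn3" where
  "diff_poly xs f = (\<lambda>t z e. \<Sum>(a, i, l, m)\<leftarrow>xs. a z e * t ^ i * (Dt ^^ l) ((Dz ^^ m) f) t z e)"

definition holo_coeffs :: "(complex \<times> complex) set \<Rightarrow> diff_monomial list \<Rightarrow> bool" where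
  "holo_coeffs \<Omega> xs \<longleftrightarrow> (\<forall>(a, i, l, m)\<in>set xs. holo2 a \<Omega>)"

text \<open>One list must serve every open \<open>U\<close> over \<Omega> and every
  \<open>f\<close>, so the coefficients depend on the operator alone. Only holomorphic
  \<open>f\<close> are tested, since the product rule and the commutation of derivatives rest on
  holomorphy.\<close>

definition diff_op :: "(complex \<times> complex) set \<Rightarrow> (fn3 \<Rightarrow> fn3) \<Rightarrow> bool" where
  "diff_op \<Omega> L \<longleftrightarrow> (\<exists>xs. holo_coeffs \<Omega> xs \<and>
     (\<forall>U f t z e. open U \<longrightarrow> U \<subseteq> UNIV \<times> \<Omega> \<longrightarrow> holo3 f U \<longrightarrow> (t, z, e) \<in> U \<longrightarrow>
        L f t z e = diff_poly xs f t z e))"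

lemma diff_poly_simps:
  "diff_poly [] f = (\<lambda>t z e. 0)"
  "diff_poly ((a, i, l, m) # xs) f = (\<lambda>t z e. a z e * t ^ i * (Dt ^^ l) ((Dz ^^ m) f) t z e + diff_poly xs f t z e)"
  "diff_poly (xs @ ys) f t z e = diff_poly xs f t z e + diff_poly ys f t z e"
  by (simp_all add: diff_poly_def)

lemma holo_coeffs_simps:
  "holo_coeffs \<Omega> []" 
  "holo_coeffs \<Omega> ((a, i, l, m) # xs) \<longleftrightarrow> holo2 a \<Omega> \<and> holo_coeffs \<Omega> xs"
  "holo_coeffs \<Omega> (xs @ ys) \<longleftrightarrow> holo_coeffs \<Omega> xs \<and> holo_coeffs \<Omega> ys"
  by (auto simp: holo_coeffs_def)

lemma holo3_diff_poly:
  assumes "open U" "U \<subseteq> UNIV \<times> \<Omega>" "holo3 f U" "holo_coeffs \<Omega> xs"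
  shows "holo3 (diff_poly xs f) U"
  using assms(4)
proof (induction xs)
  case (Cons x xs)
  obtain a i l m where x: "x = (a, i, l, m)" by (cases x)
  show ?case
    unfolding x diff_poly_simps using Cons x assms
    by (intro holo3_add holo3_mult holo3_power_fst holo3_Dt_Dz_power) (auto intro: holo3_holo2 simp: holo_coeffs_simps)
qed (simp add: diff_poly_simps holo3_const)

lemma diff_op_holo3:
  assumes "diff_op \<Omega> L" "open U" "U \<subseteq> UNIV \<times> \<Omega>" "holo3 f U"
  shows "holo3 (L f) U"
proof -
  obtain xs where xs: "holo_coeffs \<Omega> xs"
    and eq: "\<And>t z e. (t, z, e) \<in> U \<Longrightarrow> L f t z e = diff_poly xs f t z e"
    using assms unfolding diff_op_def by metis
  show ?thesis by (rule holo3_transform[OF holo3_diff_poly[OF assms(2-4) xs]]) (simp add: eq)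
qed

section \<open>Closure properties of the class of differential operators\<close>

lemma diff_op_id: "diff_op \<Omega> (\<lambda>f. f)"
  unfolding diff_op_def
  by (rule exI[of _ "[(\<lambda>z e. 1, 0, 0, 0)]"]) (simp add: diff_poly_simps holo_coeffs_simps holo2_const)

lemma diff_op_zero: "diff_op \<Omega> (\<lambda>f t z e. 0)"
  unfolding diff_op_def by (rule exI[of _ "[]"]) (simp add: diff_poly_simps holo_coeffs_simps)

lemma diff_op_add:
  assumes "diff_op \<Omega> L" "diff_op \<Omega> K"
  shows "diff_op \<Omega> (\<lambda>f t z e. L f t z e + K f t z e)"
proof -
  from assms obtain xs ys where
    "holo_coeffs \<Omega> xs" "\<And>U f t z e. open U \<Longrightarrow> U \<subseteq> UNIV \<times> \<Omega> \<Longrightarrow> holo3 f U \<Longrightarrow> (t, z, e) \<in> U \<Longrightarrow>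
        L f t z e = diff_poly xs f t z e"
    "holo_coeffs \<Omega> ys" "\<And>U f t z e. open U \<Longrightarrow> U \<subseteq> UNIV \<times> \<Omega> \<Longrightarrow> holo3 f U \<Longrightarrow> (t, z, e) \<in> U \<Longrightarrow>
        K f t z e = diff_poly ys f t z e"
    unfolding diff_op_def by metis
  then show ?thesis
    unfolding diff_op_def by (intro exI[of _ "xs @ ys"]) (auto simp: diff_poly_simps holo_coeffs_simps)
qed

lemma diff_op_mult:
  assumes L: "diff_op \<Omega> L" and a: "holo2 a \<Omega>"
  shows "diff_op \<Omega> (\<lambda>f t z e. a z e * t ^ i * L f t z e)"
proof -
  let ?M = "map (\<lambda>(b, j, l, m). (\<lambda>z e. a z e * b z e, i + j, l, m))"
  have "diff_poly (?M xs) f t z e = a z e * t ^ i * diff_poly xs f t z e" for xs f t z e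
    by (induction xs) (auto simp: diff_poly_simps algebra_simps power_add)
  moreover have "holo_coeffs \<Omega> xs \<Longrightarrow> holo_coeffs \<Omega> (?M xs)" for xs
    using a by (auto simp: holo_coeffs_def intro: holo2_mult)
  moreover obtain xs where "holo_coeffs \<Omega> xs" "\<And>U f t z e. open U \<Longrightarrow> U \<subseteq> UNIV \<times> \<Omega> \<Longrightarrow>
      holo3 f U \<Longrightarrow> (t, z, e) \<in> U \<Longrightarrow> L f t z e = diff_poly xs f t z e"
    using L unfolding diff_op_def by metis
  ultimately show ?thesis
    unfolding diff_op_def by (intro exI[of _ "?M xs"]) simp
qed

lemma diff_op_sum:
  assumes "finite K" "\<And>k. k \<in> K \<Longrightarrow> diff_op \<Omega> (L k)"
  shows "diff_op \<Omega> (\<lambda>f t z e. \<Sum>k\<in>K. L k f t z e)"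
  using assms by (induction K) (simp_all add: diff_op_zero diff_op_add)

text \<open>By the product rule each entry splits in two: either \<open>t ^ i\<close> is
  differentiated or \<open>l\<close> grows. For \<open>i = 0\<close> the truncated exponent
  \<open>i - 1\<close> is harmless, as its coefficient vanishes.\<close>

lemma Dt_diff_poly:
  assumes U: "open U" "U \<subseteq> UNIV \<times> \<Omega>" "holo3 f U" "(t, z, e) \<in> U" and xs: "holo_coeffs \<Omega> xs"
  shows "Dt (diff_poly xs f) t z e = diff_poly
     (concat (map (\<lambda>(a, i, l, m). [(\<lambda>z e. of_nat i * a z e, i - 1, l, m), (a, i, Suc l, m)]) xs)) f t z e"
  using xs
proof (induction xs)
  case (Cons x xs)
  obtain a i l m where x: "x = (a, i, l, m)" by (cases x)
  have a: "holo3 (\<lambda>t z e. a z e) U"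
    using Cons.prems U x by (auto simp: holo_coeffs_simps intro: holo3_holo2)
  have g: "holo3 ((Dt ^^ l) ((Dz ^^ m) f)) U" by (intro holo3_Dt_Dz_power U)
  have xs: "holo_coeffs \<Omega> xs" using Cons.prems x by (simp add: holo_coeffs_simps)
  have "deriv (\<lambda>t. t ^ i) t = of_nat i * t ^ (i - 1)"
    by (rule DERIV_imp_deriv) (auto intro!: derivative_eq_intros)
  then have "Dt (\<lambda>t z e. a z e * t ^ i) t z e = of_nat i * a z e * t ^ (i - 1)"
    unfolding Dt_mult[OF U(1) a holo3_power_fst U(4)] by (simp add: Dt_def)
  moreover have "Dt (diff_poly (x # xs) f) t z e =
      Dt (\<lambda>t z e. a z e * t ^ i * (Dt ^^ l) ((Dz ^^ m) f) t z e) t z e + Dt (diff_poly xs f) t z e"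
    unfolding x diff_poly_simps
    by (intro Dt_add[OF U(1)] holo3_mult a holo3_power_fst g holo3_diff_poly[OF U(1-3) xs] U(4))
  moreover have "Dt (\<lambda>t z e. a z e * t ^ i * (Dt ^^ l) ((Dz ^^ m) f) t z e) t z e =
      a z e * t ^ i * (Dt ^^ Suc l) ((Dz ^^ m) f) t z e + Dt (\<lambda>t z e. a z e * t ^ i) t z e * (Dt ^^ l) ((Dz ^^ m) f) t z e"
    using Dt_mult[OF U(1) holo3_mult[OF a holo3_power_fst] g U(4)] by simp
  ultimately show ?case
    using Cons.IH[OF xs] by (simp add: x diff_poly_simps)
qed (simp add: diff_poly_simps Dt_def)

text \<open>Here the product rule hits the coefficient or the function, as \<open>t ^ i\<close> is
  constant in \<open>z\<close>. In the second case \<open>Dz\<close> has to be moved past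
  \<open>Dt ^^ l\<close> to restore the order of an entry.\<close>

lemma Dz_diff_poly:
  assumes U: "open U" "U \<subseteq> UNIV \<times> \<Omega>" "holo3 f U" "(t, z, e) \<in> U" and xs: "holo_coeffs \<Omega> xs"
  shows "Dz (diff_poly xs f) t z e = diff_poly
     (concat (map (\<lambda>(a, i, l, m). [(\<lambda>z e. deriv (\<lambda>z. a z e) z, i, l, m), (a, i, l, Suc m)]) xs)) f t z e"
  using xs
proof (induction xs)
  case (Cons x xs)
  obtain a i l m where x: "x = (a, i, l, m)" by (cases x)
  have a: "holo3 (\<lambda>t z e. a z e) U"
    using Cons.prems U x by (auto simp: holo_coeffs_simps intro: holo3_holo2)
  have g: "holo3 ((Dt ^^ l) ((Dz ^^ m) f)) U" by (intro holo3_Dt_Dz_power U)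
  have xs: "holo_coeffs \<Omega> xs" using Cons.prems x by (simp add: holo_coeffs_simps)
  have "Dz (\<lambda>t z e. a z e * t ^ i) t z e = deriv (\<lambda>z. a z e) z * t ^ i"
    unfolding Dz_mult[OF U(1) a holo3_power_fst U(4)] by (simp add: Dz_def)
  moreover have "Dz (diff_poly (x # xs) f) t z e =
      Dz (\<lambda>t z e. a z e * t ^ i * (Dt ^^ l) ((Dz ^^ m) f) t z e) t z e + Dz (diff_poly xs f) t z e"
    unfolding x diff_poly_simps
    by (intro Dz_add[OF U(1)] holo3_mult a holo3_power_fst g holo3_diff_poly[OF U(1-3) xs] U(4))
  moreover have "Dz (\<lambda>t z e. a z e * t ^ i * (Dt ^^ l) ((Dz ^^ m) f) t z e) t z e =
      a z e * t ^ i * (Dt ^^ l) ((Dz ^^ Suc m) f) t z e + Dz (\<lambda>t z e. a z e * t ^ i) t z e * (Dt ^^ l) ((Dz ^^ m) f) t z e"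
    using Dz_mult[OF U(1) holo3_mult[OF a holo3_power_fst] g U(4)]
      Dz_Dt_power_commute[OF U(1) holo3_Dt_Dz_power[OF U(1,3), of 0 m] U(4), of l] by simp
  ultimately show ?case
    using Cons.IH[OF xs] by (simp add: x diff_poly_simps)
qed (simp add: diff_poly_simps Dz_def)

lemma diff_op_Dt:
  assumes "diff_op \<Omega> L"
  shows "diff_op \<Omega> (\<lambda>f. Dt (L f))"
proof -
  obtain xs where xs: "holo_coeffs \<Omega> xs"
    and eq: "\<And>U f t z e. open U \<Longrightarrow> U \<subseteq> UNIV \<times> \<Omega> \<Longrightarrow> holo3 f U \<Longrightarrow> (t, z, e) \<in> U \<Longrightarrow>
        L f t z e = diff_poly xs f t z e"
    using assms unfolding diff_op_def by metis
  let ?ys = "concat (map (\<lambda>(a, i, l, m). [(\<lambda>z e. of_nat i * a z e, i - 1, l, m), (a, i, Suc l, m)]) xs)"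
  have "holo_coeffs \<Omega> ?ys"
    using xs by (induction xs) (auto simp: holo_coeffs_simps intro!: holo2_mult holo2_const)
  moreover have "Dt (L f) t z e = diff_poly ?ys f t z e"
    if "open U" "U \<subseteq> UNIV \<times> \<Omega>" "holo3 f U" "(t, z, e) \<in> U" for U f t z e
    using Dt_cong_open[OF that(1) eq[OF that(1-3)] that(4)] Dt_diff_poly[OF that xs] by simp
  ultimately show ?thesis unfolding diff_op_def by blast
qed

text \<open>Unlike \<open>Dt\<close>, this differentiates the coefficients themselves; \<Omega> is
  open so that their derivatives are again holomorphic there.\<close>

lemma diff_op_Dz:
  assumes \<Omega>: "open \<Omega>" and "diff_op \<Omega> L"
  shows "diff_op \<Omega> (\<lambda>f. Dz (L f))"
proof -
  obtain xs where xs: "holo_coeffs \<Omega> xs"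
    and eq: "\<And>U f t z e. open U \<Longrightarrow> U \<subseteq> UNIV \<times> \<Omega> \<Longrightarrow> holo3 f U \<Longrightarrow> (t, z, e) \<in> U \<Longrightarrow>
        L f t z e = diff_poly xs f t z e"
    using assms unfolding diff_op_def by metis
  let ?ys = "concat (map (\<lambda>(a, i, l, m). [(\<lambda>z e. deriv (\<lambda>z. a z e) z, i, l, m), (a, i, l, Suc m)]) xs)"
  have "holo_coeffs \<Omega> ?ys"
    using xs by (induction xs) (auto simp: holo_coeffs_simps intro: holo2_partial_deriv[OF \<Omega>])
  moreover have "Dz (L f) t z e = diff_poly ?ys f t z e"
    if "open U" "U \<subseteq> UNIV \<times> \<Omega>" "holo3 f U" "(t, z, e) \<in> U" for U f t z e
    using Dz_cong_open[OF that(1) eq[OF that(1-3)] that(4)] Dz_diff_poly[OF that xs] by simp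
  ultimately show ?thesis unfolding diff_op_def by blast
qed

lemma diff_op_t2Dt: "diff_op \<Omega> L \<Longrightarrow> diff_op \<Omega> (\<lambda>f. t2Dt (L f))"
  using diff_op_mult[OF diff_op_Dt holo2_const[of 1], of \<Omega> L 2] by (simp add: t2Dt_def)

lemma diff_op_et2Dt: "diff_op \<Omega> L \<Longrightarrow> diff_op \<Omega> (\<lambda>f. et2Dt (L f))"
  using diff_op_mult[OF diff_op_Dt holo2_snd, of \<Omega> L 2] by (simp add: et2Dt_def)

lemma diff_op_funpow:
  assumes "\<And>L. diff_op \<Omega> L \<Longrightarrow> diff_op \<Omega> (\<lambda>f. D (L f))" "diff_op \<Omega> L"
  shows "diff_op \<Omega> (\<lambda>f. (D ^^ k) (L f))"
  by (induction k) (simp_all add: assms)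

lemma diff_op_poly_et2Dt:
  assumes "diff_op \<Omega> L" shows "diff_op \<Omega> (\<lambda>f. poly_et2Dt P (L f))"
proof -
  \<comment> \<open>The factor \<open>t ^ 0\<close> only gives the terms the shape expected by
    \<open>diff_op_mult\<close>.\<close>
  have "diff_op \<Omega> (\<lambda>f t z e. \<Sum>i\<le>degree P. coeff P i * t ^ 0 * (et2Dt ^^ i) (L f) t z e)"
    by (intro diff_op_sum diff_op_mult[OF _ holo2_const] diff_op_funpow diff_op_et2Dt assms) simp
  then show ?thesis by (simp add: poly_et2Dt_def)
qed

lemma diff_op_op_P2:
  assumes \<Omega>: "open \<Omega>" and B: "finite B" and d: "\<And>l. l \<in> B \<Longrightarrow> holo2 (d l) \<Omega>"
  shows "diff_op \<Omega> (op_P2 B d PB SB)"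
proof -
  \<comment> \<open>The subtraction is written as a sum with coefficients
    \<open>- 1 * d l z e\<close>, to which closure under sums and multiplication applies.\<close>
  have "diff_op \<Omega> (\<lambda>f t z e. poly_et2Dt PB ((Dz ^^ SB) f) t z e +
     (\<Sum>l\<in>B. - 1 * d l z e * t ^ fst l * (Dt ^^ fst (snd l)) ((Dz ^^ snd (snd l)) f) t z e))"
    by (intro diff_op_add diff_op_poly_et2Dt diff_op_sum diff_op_mult diff_op_funpow
      diff_op_Dt diff_op_Dz diff_op_id \<Omega> B holo2_mult holo2_const d)
  moreover have "op_P2 B d PB SB = (\<lambda>f t z e. poly_et2Dt PB ((Dz ^^ SB) f) t z e +
     (\<Sum>l\<in>B. - 1 * d l z e * t ^ fst l * (Dt ^^ fst (snd l)) ((Dz ^^ snd (snd l)) f) t z e))"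
    by (intro ext) (simp add: op_P2_def sum_negf split_beta)
  ultimately show ?thesis by simp
qed

section \<open>Collecting like terms\<close>

lemma diff_poly_collect:
  assumes "\<And>a i l m. (a, i, l, m) \<in> set xs \<Longrightarrow> i \<le> N \<and> l \<le> N \<and> m \<le> N"
  shows "diff_poly xs f t z e = (\<Sum>l\<le>N. \<Sum>m\<le>N. (\<Sum>i\<le>N.
     (\<Sum>(a, i', l', m')\<leftarrow>xs. if i' = i \<and> l' = l \<and> m' = m then a z e else 0) * t ^ i) *
       (Dt ^^ l) ((Dz ^^ m) f) t z e)"
  using assms
proof (induction xs)
  case (Cons x xs)
  obtain a i' l' m' where x: "x = (a, i', l', m')" by (cases x)
  have le: "i' \<le> N" "l' \<le> N" "m' \<le> N" using Cons.prems[of a i' l' m'] x by auto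
  let ?D = "\<lambda>l m. (Dt ^^ l) ((Dz ^^ m) f) t z e"
  \<comment> \<open>The head entry contributes at a single index triple. The condition on
    \<open>i\<close> is isolated first, so that the sum over \<open>i\<close> collapses before the
    two others; the bounds \<open>le\<close> keep each index in range.\<close>
  have "(\<Sum>i\<le>N. (if i' = i \<and> l' = l \<and> m' = m then a z e else 0) * t ^ i) =
      (\<Sum>i\<le>N. if i' = i then (if l' = l \<and> m' = m then a z e * t ^ i else 0) else 0)" for l m
    by (intro sum.cong) auto
  then have "(\<Sum>i\<le>N. (if i' = i \<and> l' = l \<and> m' = m then a z e else 0) * t ^ i) =
      (if l' = l \<and> m' = m then a z e * t ^ i' else 0)" for l m
    using le by simp
  then have "(\<Sum>l\<le>N. \<Sum>m\<le>N. (\<Sum>i\<le>N. (if i' = i \<and> l' = l \<and> m' = m then a z e else 0) * t ^ i) * ?D l m)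
    = (\<Sum>l\<le>N. \<Sum>m\<le>N. (if l' = l \<and> m' = m then a z e * t ^ i' else 0) * ?D l m)"
    by simp
  also have "\<dots> = (\<Sum>l\<le>N. if l' = l then (\<Sum>m\<le>N. if m' = m then a z e * t ^ i' * ?D l m else 0) else 0)"
    by (intro sum.cong refl) (auto simp del: sum.delta sum.delta' intro!: sum.cong)
  also have "\<dots> = a z e * t ^ i' * ?D l' m'"
    by (simp only: sum.delta' finite_atMost atMost_iff le if_True)
  finally show ?case
    using Cons.IH[OF Cons.prems[OF list.set_intros(2)]]
    by (simp add: x diff_poly_simps distrib_right sum.distrib)
qed (simp add: diff_poly_simps)

lemma holo2_collect:
  assumes "holo_coeffs \<Omega> xs"
  shows "holo2 (\<lambda>z e. \<Sum>(a, i', l', m')\<leftarrow>xs. if i' = i \<and> l' = l \<and> m' = m then a z e else 0) \<Omega>"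
  using assms
proof (induction xs)
  case (Cons x xs)
  obtain a i' l' m' where x: "x = (a, i', l', m')" by (cases x)
  have "holo2 (\<lambda>z e. if i' = i \<and> l' = l \<and> m' = m then a z e else 0) \<Omega>"
  proof (cases "i' = i \<and> l' = l \<and> m' = m")
    case False
    then show ?thesis by (simp only: if_False holo2_const)
  qed (use Cons.prems in \<open>simp add: x holo_coeffs_simps\<close>)
  then show ?case using Cons by (simp add: x holo_coeffs_simps holo2_add)
qed (simp add: holo2_const)

section \<open>The composed operator and the Cauchy problem\<close>

text \<open>The terms of \<open>op_P1\<close> are grouped by their shift. The coefficients
  \<open>c\<close> do not involve \<open>t\<close>, so they pass inside the Moebius operator, and
  each group becomes a Moebius operator after one differential operator. Taking \<open>K\<close> to
  be \<open>op_P2\<close> gives the composed operator.\<close>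

lemma op_P1_diff_op_normal_form:
  assumes A: "finite A" and \<Omega>: "open \<Omega>" and c: "\<And>k. k \<in> A \<Longrightarrow> holo2 (c k) \<Omega>" and K: "diff_op \<Omega> K"
  shows "\<exists>N q. (\<forall>\<kappa> l m i. holo2 (q \<kappa> l m i) \<Omega>) \<and>
        (\<forall>U f t z e. open U \<and> U \<subseteq> UNIV \<times> \<Omega> \<and> holo3 f U \<and>
           (t, z, e) \<in> U \<and> moebius_ok A U t z e \<longrightarrow>
           op_P1 A c P S (K f) t z e =
           (\<Sum>\<kappa>\<in>insert 0 ((\<lambda>(k0, k1, k2). k2) ` A).
              moebius_op \<kappa> (\<lambda>t z e. \<Sum>l\<le>N. \<Sum>m\<le>N. (\<Sum>i\<le>N. q \<kappa> l m i z e * t ^ i) *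
                (Dt ^^ l) ((Dz ^^ m) f) t z e) t z e))"
proof -
  define A\<kappa> where "A\<kappa> \<kappa> = {k \<in> A. snd (snd k) = \<kappa>}" for \<kappa>
  let ?I = "insert 0 ((\<lambda>(k0, k1, k2). k2) ` A)"
  have I: "finite ?I" "snd ` snd ` A \<subseteq> ?I" using A by force+
  define F where "F k f = (t2Dt ^^ fst k) ((Dz ^^ fst (snd k)) (K f))" for k :: "nat \<times> nat \<times> nat" and f
  define G where "G f = poly_et2Dt P ((Dz ^^ S) (K f))" for f
  \<comment> \<open>The unshifted polynomial part is assigned to \<kappa> = 0, where the Moebius
    operator is the identity; this is why 0 is put into the index set even if no element of
    \<open>A\<close> has shift 0.\<close>
  define L where "L \<kappa> f = (\<lambda>t z e. (if \<kappa> = 0 then G f t z e else 0) +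
      (\<Sum>k\<in>A\<kappa> \<kappa>. - 1 * c k z e * t ^ 0 * F k f t z e))" for \<kappa> f
  have Dz: "diff_op \<Omega> (\<lambda>f. (Dz ^^ m) (K f))" for m
    by (intro diff_op_funpow diff_op_Dz \<Omega> K)
  have L: "diff_op \<Omega> (L \<kappa>)" for \<kappa>
  proof -
    have G: "diff_op \<Omega> (\<lambda>f t z e. if \<kappa> = 0 then G f t z e else 0)"
      using diff_op_poly_et2Dt[OF Dz] diff_op_zero by (cases "\<kappa> = 0") (simp_all add: G_def)
    have F: "diff_op \<Omega> (F k)" for k
      unfolding F_def by (intro diff_op_funpow[OF diff_op_t2Dt Dz])
    show ?thesis
      unfolding L_def using A c
      by (intro diff_op_add[OF G] diff_op_sum diff_op_mult[OF F] holo2_mult holo2_const) (auto simp: A\<kappa>_def)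
  qed
  have split: "op_P1 A c P S (K f) t z e = (\<Sum>\<kappa>\<in>?I. moebius_op \<kappa> (L \<kappa> f) t z e)" for f t z e
  proof -
    let ?h = "\<lambda>k. c k z e * moebius_op (snd (snd k)) (F k f) t z e"
    have "(\<Sum>\<kappa>\<in>?I. moebius_op \<kappa> (L \<kappa> f) t z e) =
        (\<Sum>\<kappa>\<in>?I. (if \<kappa> = 0 then G f t z e else 0) - (\<Sum>k | k \<in> A \<and> snd (snd k) = \<kappa>. ?h k))"
      by (intro sum.cong refl) (auto simp: L_def A\<kappa>_def moebius_op_def sum_negf)
    also have "\<dots> = G f t z e - (\<Sum>\<kappa>\<in>?I. \<Sum>k | k \<in> A \<and> snd (snd k) = \<kappa>. ?h k)"
      using I(1) by (simp add: sum_subtractf)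
    also have "(\<Sum>\<kappa>\<in>?I. \<Sum>k | k \<in> A \<and> snd (snd k) = \<kappa>. ?h k) = sum ?h A"
      by (rule sum.group[OF A I(1)]) (use I(2) in auto)
    finally show ?thesis by (simp add: op_P1_def G_def F_def split_beta)
  qed
  have "\<forall>\<kappa>. \<exists>xs. holo_coeffs \<Omega> xs \<and> (\<forall>U f t z e. open U \<longrightarrow> U \<subseteq> UNIV \<times> \<Omega> \<longrightarrow> holo3 f U \<longrightarrow>
      (t, z, e) \<in> U \<longrightarrow> L \<kappa> f t z e = diff_poly xs f t z e)"
    using L unfolding diff_op_def by blast
  then obtain xs where xs: "\<And>\<kappa>. holo_coeffs \<Omega> (xs \<kappa>)"
    and eq: "\<And>\<kappa> U f t z e. open U \<Longrightarrow> U \<subseteq> UNIV \<times> \<Omega> \<Longrightarrow> holo3 f U \<Longrightarrow> (t, z, e) \<in> U \<Longrightarrow>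
      L \<kappa> f t z e = diff_poly (xs \<kappa>) f t z e"
    by metis
  \<comment> \<open>The largest total \<open>i + l + m\<close> over the finitely many lists bounds
    all exponents at once. If every list is empty, \<open>Max X\<close> is unspecified, but then
    there is nothing to bound.\<close>
  define X where "X = (\<lambda>(a, i, l, m). i + l + m) ` (\<Union>\<kappa>\<in>?I. set (xs \<kappa>))"
  have "finite X" unfolding X_def by (intro finite_imageI finite_UN_I I(1) finite_set)
  have N: "i \<le> Max X \<and> l \<le> Max X \<and> m \<le> Max X" if "\<kappa> \<in> ?I" "(a, i, l, m) \<in> set (xs \<kappa>)" for \<kappa> a i l m
  proof -
    have "i + l + m \<in> X" using that unfolding X_def by (force intro!: image_eqI[of _ _ "(a, i, l, m)"])
    then have "i + l + m \<le> Max X" using \<open>finite X\<close> by simp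
    then show ?thesis by simp
  qed
  define q where "q \<kappa> l m i = (\<lambda>z e. \<Sum>(a, i', l', m')\<leftarrow>xs \<kappa>. if i' = i \<and> l' = l \<and> m' = m then a z e else 0)"
    for \<kappa> l m i
  show ?thesis
  proof (intro exI[of _ "Max X"] exI[of _ q] conjI allI impI, goal_cases)
    case (1 \<kappa> l m i)
    show ?case unfolding q_def by (rule holo2_collect[OF xs])
  next
    case (2 U f t z e)
    have "moebius_op \<kappa> (L \<kappa> f) t z e = moebius_op \<kappa> (\<lambda>t z e. \<Sum>l\<le>Max X. \<Sum>m\<le>Max X.
        (\<Sum>i\<le>Max X. q \<kappa> l m i z e * t ^ i) * (Dt ^^ l) ((Dz ^^ m) f) t z e) t z e" if \<kappa>: "\<kappa> \<in> ?I" for \<kappa>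
    proof -
      \<comment> \<open>For a shift from \<open>A\<close> this is \<open>moebius_ok\<close>; for
        \<kappa> = 0 the point is \<open>(t, z, e)\<close> itself.\<close>
      have "(t / (1 + of_nat \<kappa> * e * t), z, e) \<in> U"
        using 2 \<kappa> by (auto simp: moebius_ok_def)
      then show ?thesis
        using eq[of U f] 2 diff_poly_collect[OF N[OF \<kappa>]] by (simp add: moebius_op_def q_def)
    qed
    then show ?case unfolding split by (rule sum.cong[OF refl])
  qed
qed

text \<open>For fixed \<open>(z, e)\<close> this is the one-variable identity theorem for
  \<open>f - g\<close> on a connected slice: the zeros on the real segment accumulate at
  \<open>a / 2\<close>, inside the slice.\<close>

lemma holo3_identity_theorem:
  assumes W: "open W" "connected {t. (t, z, e) \<in> W}" and fg: "holo3 f W" "holo3 g W"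
    and a: "a > 0" and seg: "\<And>x. 0 < x \<Longrightarrow> x < a \<Longrightarrow> (of_real x, z, e) \<in> W"
    and eq: "\<And>x. 0 < x \<Longrightarrow> x < a \<Longrightarrow> f (of_real x) z e = g (of_real x) z e"
    and t: "(t, z, e) \<in> W"
  shows "f t z e = g t z e"
proof -
  let ?X = "(of_real :: real \<Rightarrow> complex) ` {0<..<a}"
  \<comment> \<open>Two distinct points show that the segment is no singleton; every point of such a
    connected set is a limit point of it.\<close>
  have "of_real (a / 2) \<in> ?X" "of_real (a / 3) \<in> ?X" using a by (intro imageI; simp)+
  moreover have "(of_real (a / 2) :: complex) \<noteq> of_real (a / 3)"
    using a unfolding of_real_eq_iff by simp
  ultimately have "?X \<noteq> {x}" for x by (metis singletonD)
  then have "of_real (a / 2) islimpt ?X"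
    using \<open>of_real (a / 2) \<in> ?X\<close>
    by (intro connected_imp_perfect connected_continuous_image continuous_intros) auto
  then have "(\<lambda>t. f t z e - g t z e) t = 0"
    by (rule analytic_continuation[of _ "{t. (t, z, e) \<in> W}" ?X, rotated 5])
      (use fg a seg eq t open_slices3[OF W(1)] W(2) in \<open>auto simp: holo3_def intro!: holomorphic_on_diff seg[of "a / 2", simplified]\<close>)
  then show ?thesis by simp
qed

theorem corollary1:
  fixes A B :: "(nat \<times> nat \<times> nat) set"
    and c d :: "nat \<times> nat \<times> nat \<Rightarrow> complex \<Rightarrow> complex \<Rightarrow> complex"
    and P PB :: "complex poly" and S SB n \<iota> :: nat
    and \<rho> \<epsilon>0 \<xi> b M \<sigma>1 \<sigma>2 \<sigma>3 \<zeta>2 \<zeta>3 :: real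
    and Ha Hb Jc Jd :: "int \<Rightarrow> real"
    and dir \<alpha> :: "nat \<Rightarrow> real" and r \<alpha>T RT rT \<delta> \<delta>1 \<delta>HJ \<eta> I :: real
    and Sd :: "nat \<Rightarrow> complex set" and T HJn :: "complex set"
    and H J RH RJ :: "int \<Rightarrow> complex set"
    and E :: "sector_index \<Rightarrow> complex set"
    and Ak :: "int \<Rightarrow> complex" and \<eta>A \<upsilon> :: "int \<Rightarrow> real"
    and \<gamma> :: "nat \<Rightarrow> complex \<Rightarrow> complex \<Rightarrow> real"
    and wj vj :: "nat \<Rightarrow> complex \<Rightarrow> complex \<Rightarrow> complex"
    and w v :: "complex \<Rightarrow> complex \<Rightarrow> complex fps"
    and Acoef :: "nat \<Rightarrow> nat \<Rightarrow> real"
    and u y :: "sector_index \<Rightarrow> fn3"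
    and W :: "sector_index \<Rightarrow> (complex \<times> complex \<times> complex) set"
  \<comment> \<open>first problem\<close>
  assumes pos: "\<rho> > 0" "\<epsilon>0 > 0" "\<xi> > 0" "b > 1"
    and A: "finite A"
    and c_holo: "\<And>k. k \<in> A \<Longrightarrow> holo2 (c k) (ball 0 \<rho> \<times> ball 0 \<epsilon>0)"
    and c_bdd: "\<And>k. k \<in> A \<Longrightarrow> bounded ((\<lambda>(z, e). c k z e) ` (ball 0 \<rho> \<times> ball 0 \<epsilon>0))"
    and S: "S \<ge> 1"
    and P: "P \<noteq> 0" "\<And>x. poly P x = 0 \<Longrightarrow> Re x > 0"
    and A_S: "\<And>k0 k1 k2. (k0, k1, k2) \<in> A \<Longrightarrow>
          real S \<ge> real k1 + b * real k0 + b * real k2 / \<xi> \<and> S > k1"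
    and M: "M > (\<Sum>m. real (m + 1) powr (- b))"
  \<comment> \<open>strips\<close>
    and n: "n \<ge> 1"
    and H_def: "\<And>k. H k = strip (Ha k) (Hb k)" and J_def: "\<And>k. J k = strip (Jc k) (Jd k)"
    and HJn_def: "HJn = strip (Jc (- int n)) (Hb (int n))"
    and J0: "Jc 0 < 0" "0 < Jd 0"
    and strips: "\<And>k. k \<in> {- int n..int n - 1} \<Longrightarrow>
          Jc k < Ha k \<and> Ha k < Jd k \<and> Jc (k + 1) < Hb k \<and> Hb k < Jd (k + 1) \<and>
          Ha (k + 1) > Hb k \<and> Jc (k + 1) > Jd k"
    and strips_last: "Jc (int n) < Ha (int n)" "Ha (int n) < Jd (int n)" "Hb (int n) > Jd (int n)"
    and Ha_nz: "\<And>k. k \<in> {- int n..int n} \<Longrightarrow> Ha k \<noteq> 0"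
  \<comment> \<open>norms\<close>
    and norm_pars: "\<sigma>1 > 0" "\<sigma>2 > 0" "\<sigma>3 > 0" "\<zeta>2 > 0" "\<zeta>3 > 0" "\<xi> \<le> min \<sigma>3 \<zeta>3"
  \<comment> \<open>sectors\<close>
    and iota: "\<iota> \<ge> 2"
    and Sd: "\<And>p. p < \<iota> \<Longrightarrow> 0 < \<alpha> p \<and> Sd p = usector (dir p) (\<alpha> p) \<and> Sd p \<subseteq> {z. Re z > 0}"
    and Sd_next: "\<And>p. Suc p < \<iota> \<Longrightarrow> dir p < dir (Suc p) \<and> Sd p \<inter> Sd (Suc p) = {}"
    and r: "r > 0" "ball 0 r \<inter> {z. Re z \<le> 0} \<subseteq> J 0"
    and P_root: "\<And>p x. p < \<iota> \<Longrightarrow> x \<in> closure (Sd p) \<union> cball 0 r \<Longrightarrow> poly P x \<noteq> 0"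
    and T: "0 < \<alpha>T" "\<alpha>T \<le> pi" "0 < RT" "T = bsector 0 \<alpha>T RT"
    and E_HJ: "\<And>k. k \<in> {- int n..int n} \<Longrightarrow>
          \<exists>\<theta> a R. 0 < a \<and> a < pi / 2 \<and> 0 < R \<and> E (HJ k) = bsector \<theta> a R"
    and E_SD: "\<And>p. p < \<iota> \<Longrightarrow>
          \<exists>\<theta> a R. 0 < a \<and> a \<le> pi \<and> 0 < R \<and> E (SD p) = bsector \<theta> a R"
    and E_sub: "\<And>i. i \<in> sector_indices n \<iota> \<Longrightarrow> E i \<subseteq> ball 0 \<epsilon>0"
    and dHJ: "\<delta>HJ > 0"
    and E_HJ_arg: "\<And>k e t. k \<in> {- int n..int n} \<Longrightarrow> e \<in> E (HJ k) \<Longrightarrow> t \<in> T \<Longrightarrow>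
          angle_in \<delta>HJ (pi - Arg t - Arg e)"
    and eta: "\<eta> > 0"
    and E_SD_arg: "\<And>p e t. p < \<iota> \<Longrightarrow> e \<in> E (SD p) \<Longrightarrow> t \<in> T \<Longrightarrow>
          cis (\<gamma> p t e) \<in> Sd p \<and> angle_in \<eta> (\<gamma> p t e - Arg t - Arg e)"
    and cover_HJ: "\<And>k. k \<in> {- int n..int n - 1} \<Longrightarrow> E (HJ k) \<inter> E (HJ (k + 1)) \<noteq> {}"
    and cover_SD: "\<And>p. Suc p < \<iota> \<Longrightarrow> E (SD (Suc p)) \<inter> E (SD p) \<noteq> {}"
    and cover_ends: "E (HJ (- int n)) \<inter> E (SD 0) \<noteq> {}" "E (HJ (int n)) \<inter> E (SD (\<iota> - 1)) \<noteq> {}"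
    and cover_union: "\<exists>U. 0 \<in> interior U \<and> (\<Union>i\<in>sector_indices n \<iota>. E i) = U - {0}"
    and cover_three: "\<And>i j l. i \<in> sector_indices n \<iota> \<Longrightarrow> j \<in> sector_indices n \<iota> \<Longrightarrow>
          l \<in> sector_indices n \<iota> \<Longrightarrow> i \<noteq> j \<Longrightarrow> j \<noteq> l \<Longrightarrow> i \<noteq> l \<Longrightarrow> E i \<inter> E j \<inter> E l = {}"
  \<comment> \<open>paths\<close>
    and Ak: "\<And>k. k \<in> {- int n..int n} \<Longrightarrow> Ak k \<in> H k \<and> \<eta>A k > 0"
    and Ak_arg: "\<And>k e t. k \<in> {- int n..int n} \<Longrightarrow> e \<in> E (HJ k) \<Longrightarrow> t \<in> T \<Longrightarrow>
          angle_in (\<eta>A k) (Arg (Ak k) - Arg e - Arg t)"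
  \<comment> \<open>initial data of the first problem\<close>
    and wj_HJ: "\<And>j. j < S \<Longrightarrow> holo2 (wj j) (interior HJn \<times> (ball 0 \<epsilon>0 - {0})) \<and>
          continuous_on (HJn \<times> (ball 0 \<epsilon>0 - {0})) (\<lambda>(\<tau>, e). wj j \<tau> e)"
    and wj_Sd: "\<And>j p. j < S \<Longrightarrow> p < \<iota> \<Longrightarrow>
          holo2 (wj j) ((Sd p \<union> ball 0 r) \<times> (ball 0 \<epsilon>0 - {0})) \<and>
          continuous_on ((closure (Sd p) \<union> cball 0 r) \<times> (ball 0 \<epsilon>0 - {0})) (\<lambda>(\<tau>, e). wj j \<tau> e)"
    and I: "I > 0" and delta: "\<delta> > 0" "\<delta> < \<rho>"
    and wj_H: "\<And>h e k. h < S \<Longrightarrow> e \<in> ball 0 \<epsilon>0 - {0} \<Longrightarrow> k \<in> {- int n..int n} \<Longrightarrow>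
          (\<Sum>j\<le>S - 1 - h. normH M \<sigma>1 \<sigma>2 \<sigma>3 (H k) e (\<lambda>\<tau>. wj (j + h) \<tau> e) * ennreal (\<delta> ^ j / fact j))
            \<le> ennreal I"
    and wj_J: "\<And>h e k. h < S \<Longrightarrow> e \<in> ball 0 \<epsilon>0 - {0} \<Longrightarrow> k \<in> {- int n..int n} \<Longrightarrow>
          (\<Sum>j\<le>S - 1 - h. normJ \<sigma>1 \<zeta>2 \<zeta>3 (J k) e (\<lambda>\<tau>. wj (j + h) \<tau> e) * ennreal (\<delta> ^ j / fact j))
            \<le> ennreal I"
    and wj_S: "\<And>h e p. h < S \<Longrightarrow> e \<in> ball 0 \<epsilon>0 - {0} \<Longrightarrow> p < \<iota> \<Longrightarrow>
          (\<Sum>j\<le>S - 1 - h. normS \<sigma>1 (Sd p \<union> ball 0 r) e (\<lambda>\<tau>. wj (j + h) \<tau> e) * ennreal (\<delta> ^ j / fact j))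
            \<le> ennreal I"
  \<comment> \<open>the formal solution \<open>w\<close> in the Borel plane and its convergence\<close>
    and w_init: "\<And>\<tau> e j. \<tau> \<in> HJn \<union> (\<Union>p<\<iota>. closure (Sd p) \<union> cball 0 r) \<Longrightarrow> e \<in> ball 0 \<epsilon>0 - {0} \<Longrightarrow>
          j < S \<Longrightarrow> fps_nth ((fps_deriv ^^ j) (w \<tau> e)) 0 = wj j \<tau> e"
    and w_eq: "\<And>\<tau> e. \<tau> \<in> HJn \<union> (\<Union>p<\<iota>. closure (Sd p) \<union> cball 0 r) \<Longrightarrow> e \<in> ball 0 \<epsilon>0 - {0} \<Longrightarrow>
          (fps_deriv ^^ S) (w \<tau> e) =
          (\<Sum>(k0, k1, k2)\<in>A.
             fps_const (1 / poly P \<tau> * (1 / e ^ k0) * \<tau> ^ k0 * exp (- of_nat k2 * \<tau>))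
             * fps_expansion (\<lambda>z. c (k0, k1, k2) z e) 0 * (fps_deriv ^^ k1) (w \<tau> e))"
    and delta1: "0 < \<delta>1" "\<delta>1 < 1" and rT: "rT > 0"
    and w_conv: "\<And>\<tau> e. \<tau> \<in> HJn \<union> (\<Union>p<\<iota>. closure (Sd p) \<union> cball 0 r) \<Longrightarrow> e \<in> ball 0 \<epsilon>0 - {0} \<Longrightarrow>
          ereal (\<delta> * \<delta>1) \<le> fps_conv_radius (w \<tau> e)"
  \<comment> \<open>domains \<open>W i\<close> of holomorphy for \<open>u i\<close> and \<open>y i\<close>; \<open>W i = sol_dom \<dots>\<close> is allowed, but a larger
      \<open>W i\<close> makes the equations meaningful also where a Moebius map leaves \<open>T \<inter> ball 0 rT\<close>\<close>
    and W: "\<And>i. i \<in> sector_indices n \<iota> \<Longrightarrow> open (W i) \<and> sol_dom T rT (\<delta> * \<delta>1) (E i) \<subseteq> W i \<and>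
          W i \<subseteq> UNIV \<times> ball 0 (\<delta> * \<delta>1) \<times> E i \<and> (\<forall>z e. connected {t. (t, z, e) \<in> W i})"
  \<comment> \<open>the bounded holomorphic solutions \<open>u i\<close> of the first problem\<close>
    and u_laplace: "\<And>i t z e. i \<in> sector_indices n \<iota> \<Longrightarrow> (t, z, e) \<in> sol_dom T rT (\<delta> * \<delta>1) (E i) \<Longrightarrow>
          u i t z e = laplace Ak \<gamma> i (\<lambda>\<tau>. eval_fps (w \<tau> e) z) t e"
    and u_holo: "\<And>i. i \<in> sector_indices n \<iota> \<Longrightarrow> holo3 (u i) (W i)"
    and u_bdd: "\<And>i. i \<in> sector_indices n \<iota> \<Longrightarrow>
          bounded ((\<lambda>(t, z, e). u i t z e) ` sol_dom T rT (\<delta> * \<delta>1) (E i))"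
    and u_eq: "\<And>i t z e. i \<in> sector_indices n \<iota> \<Longrightarrow> (t, z, e) \<in> sol_dom T rT (\<delta> * \<delta>1) (E i) \<Longrightarrow>
          moebius_ok A (W i) t z e \<Longrightarrow>
          poly_et2Dt P ((Dz ^^ S) (u i)) t z e =
          (\<Sum>(k0, k1, k2)\<in>A. c (k0, k1, k2) z e *
             ((t2Dt ^^ k0) ((Dz ^^ k1) (u i))) (t / (1 + of_nat k2 * e * t)) z e)"
    and u_init: "\<And>i t e j. i \<in> sector_indices n \<iota> \<Longrightarrow> t \<in> T \<inter> ball 0 rT \<Longrightarrow> e \<in> E i \<Longrightarrow> j < S \<Longrightarrow>
          (Dz ^^ j) (u i) t 0 e = laplace Ak \<gamma> i (\<lambda>\<tau>. wj j \<tau> e) t e"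
  \<comment> \<open>second problem\<close>
    and B: "finite B"
    and d_holo: "\<And>l. l \<in> B \<Longrightarrow> holo2 (d l) (ball 0 \<rho> \<times> ball 0 \<epsilon>0)"
    and d_bdd: "\<And>l. l \<in> B \<Longrightarrow> bounded ((\<lambda>(z, e). d l z e) ` (ball 0 \<rho> \<times> ball 0 \<epsilon>0))"
    and SB: "SB \<ge> 1"
    and PB: "PB \<noteq> 0"
          "degree PB = 0 \<or> (\<forall>x. poly PB x = 0 \<longrightarrow> Re x > 0 \<and> (\<forall>p<\<iota>. x \<notin> closure (Sd p) \<union> cball 0 r))"
    and B_SB: "\<And>l0 l1 l2. (l0, l1, l2) \<in> B \<Longrightarrow>
          real SB \<ge> b * (real l0 - real l1) + real l2 \<and> SB > l2 \<and> l1 \<ge> 1 \<and> l0 \<ge> 2 * l1 + 1"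
    and ups: "\<And>k. k \<in> {- int n..int n} \<Longrightarrow> \<upsilon> k < 0 \<and> \<upsilon> k < Re (Ak k)"
    and RH_def: "\<And>k. RH k = rstrip (Ha k) (Hb k) (\<upsilon> k)"
    and RJ_def: "\<And>k. RJ k = rstrip (Jc k) (Jd k) (\<upsilon> k)"
    and vj_holo: "\<And>j e. j < SB \<Longrightarrow> e \<in> ball 0 \<epsilon>0 - {0} \<Longrightarrow>
          (\<lambda>\<tau>. vj j \<tau> e) holomorphic_on ball 0 r \<and> (\<lambda>\<tau>. vj j \<tau> e) holomorphic_on interior HJn \<and>
          (\<forall>p<\<iota>. (\<lambda>\<tau>. vj j \<tau> e) holomorphic_on Sd p)"
    and vj_cont: "\<And>j e. j < SB \<Longrightarrow> e \<in> ball 0 \<epsilon>0 - {0} \<Longrightarrow>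
          (\<forall>k\<in>{- int n..int n}. continuous_on (RH k) (\<lambda>\<tau>. vj j \<tau> e) \<and> continuous_on (RJ k) (\<lambda>\<tau>. vj j \<tau> e)) \<and>
          (\<forall>p<\<iota>. continuous_on (closure (Sd p) \<union> cball 0 r) (\<lambda>\<tau>. vj j \<tau> e))"
    and vj_eps: "\<And>j \<tau>. j < SB \<Longrightarrow> \<tau> \<in> HJn \<union> (\<Union>p<\<iota>. closure (Sd p) \<union> cball 0 r) \<Longrightarrow>
          (\<lambda>e. vj j \<tau> e) holomorphic_on (ball 0 \<epsilon>0 - {0})"
    and vj_norm: "\<exists>C. \<forall>j<SB. \<forall>e\<in>ball 0 \<epsilon>0 - {0}.
          (\<forall>k\<in>{- int n..int n}. normS \<sigma>1 (RH k) e (\<lambda>\<tau>. vj j \<tau> e) \<le> ennreal C \<and>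
             normJ \<sigma>1 \<zeta>2 \<zeta>3 (RJ k) e (\<lambda>\<tau>. vj j \<tau> e) \<le> ennreal C) \<and>
          (\<forall>p<\<iota>. normS \<sigma>1 (Sd p \<union> ball 0 r) e (\<lambda>\<tau>. vj j \<tau> e) \<le> ennreal C)"
  \<comment> \<open>\<open>t^(2 l) \<partial>\<^sub>t^l = (t^2 \<partial>\<^sub>t)^l + (\<Sum>1\<le>q\<le>l - 1. Acoef l q t^(l - q) (t^2 \<partial>\<^sub>t)^q)\<close>\<close>
    and Acoef: "\<And>l0 l1 l2 f U t. (l0, l1, l2) \<in> B \<Longrightarrow> open U \<Longrightarrow> f holomorphic_on U \<Longrightarrow> t \<in> U \<Longrightarrow>
          t ^ (2 * l1) * (deriv ^^ l1) f t =
          ((\<lambda>g s. s\<^sup>2 * deriv g s) ^^ l1) f t +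
          (\<Sum>q\<in>{1..<l1}. of_real (Acoef l1 q) * t ^ (l1 - q) * ((\<lambda>g s. s\<^sup>2 * deriv g s) ^^ q) f t)"
  \<comment> \<open>the power series \<open>v\<close> in the Borel plane\<close>
    and v_conv: "\<And>\<tau> e. \<tau> \<in> HJn \<union> (\<Union>p<\<iota>. closure (Sd p) \<union> cball 0 r) \<Longrightarrow> e \<in> ball 0 \<epsilon>0 - {0} \<Longrightarrow>
          ereal (\<delta> * \<delta>1) \<le> fps_conv_radius (v \<tau> e)"
    and v_init: "\<And>\<tau> e j. \<tau> \<in> HJn \<union> (\<Union>p<\<iota>. closure (Sd p) \<union> cball 0 r) \<Longrightarrow> e \<in> ball 0 \<epsilon>0 - {0} \<Longrightarrow>
          j < SB \<Longrightarrow> (deriv ^^ j) (\<lambda>z. eval_fps (v \<tau> e) z) 0 = vj j \<tau> e"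
    and v_eq: "\<And>D g \<tau> z e. D \<in> insert HJn ((\<lambda>p. closure (Sd p) \<union> cball 0 r) ` {..<\<iota>}) \<Longrightarrow>
          valid_path g \<Longrightarrow> pathstart g = 0 \<Longrightarrow> pathfinish g = \<tau> \<Longrightarrow> path_image g \<subseteq> D \<Longrightarrow>
          z \<in> ball 0 (\<delta> * \<delta>1) \<Longrightarrow> e \<in> ball 0 \<epsilon>0 - {0} \<Longrightarrow>
          (deriv ^^ SB) (\<lambda>x. eval_fps (v \<tau> e) x) z =
          (\<Sum>(l0, l1, l2)\<in>B. d (l0, l1, l2) z e / poly PB \<tau> *
             (e powi (int l1 - int l0) * \<tau> / Gamma (of_nat (l0 - 2 * l1)) *
                contour_integral g (\<lambda>s. (\<tau> - s) ^ (l0 - 2 * l1 - 1) * s ^ l1 *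
                  (deriv ^^ l2) (\<lambda>x. eval_fps (v s e) x) z / s) +
              (\<Sum>q\<in>{1..<l1}. of_real (Acoef l1 q) * e powi (int l1 - int l0) * \<tau>
                  / Gamma (of_nat (l0 - 2 * l1 + l1 - q)) *
                contour_integral g (\<lambda>s. (\<tau> - s) ^ (l0 - 2 * l1 + l1 - q - 1) * s ^ q *
                  (deriv ^^ l2) (\<lambda>x. eval_fps (v s e) x) z / s))))
          + eval_fps (w \<tau> e) z"
  \<comment> \<open>the bounded holomorphic solutions \<open>y i\<close> of the second problem\<close>
    and y_laplace: "\<And>i t z e. i \<in> sector_indices n \<iota> \<Longrightarrow> (t, z, e) \<in> sol_dom T rT (\<delta> * \<delta>1) (E i) \<Longrightarrow>
          y i t z e = laplace Ak \<gamma> i (\<lambda>\<tau>. eval_fps (v \<tau> e) z) t e"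
    and y_holo: "\<And>i. i \<in> sector_indices n \<iota> \<Longrightarrow> holo3 (y i) (W i)"
    and y_bdd: "\<And>i. i \<in> sector_indices n \<iota> \<Longrightarrow>
          bounded ((\<lambda>(t, z, e). y i t z e) ` sol_dom T rT (\<delta> * \<delta>1) (E i))"
    and y_eq: "\<And>i t z e. i \<in> sector_indices n \<iota> \<Longrightarrow> (t, z, e) \<in> sol_dom T rT (\<delta> * \<delta>1) (E i) \<Longrightarrow>
          poly_et2Dt PB ((Dz ^^ SB) (y i)) t z e =
          (\<Sum>(l0, l1, l2)\<in>B. d (l0, l1, l2) z e * t ^ l0 * (Dt ^^ l1) ((Dz ^^ l2) (y i)) t z e)
          + u i t z e"
    and y_init: "\<And>i t e j. i \<in> sector_indices n \<iota> \<Longrightarrow> t \<in> T \<inter> ball 0 rT \<Longrightarrow> e \<in> E i \<Longrightarrow> j < SB \<Longrightarrow>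
          (Dz ^^ j) (y i) t 0 e = laplace Ak \<gamma> i (\<lambda>\<tau>. vj j \<tau> e) t e"
  shows
    "(\<forall>i\<in>sector_indices n \<iota>.
        holo3 (y i) (sol_dom T rT (\<delta> * \<delta>1) (E i)) \<and>
        (\<forall>(t, z, e)\<in>sol_dom T rT (\<delta> * \<delta>1) (E i). moebius_ok A (W i) t z e \<longrightarrow>
           op_P1 A c P S (op_P2 B d PB SB (y i)) t z e = 0) \<and>
        (\<forall>t\<in>T \<inter> ball 0 rT. \<forall>e\<in>E i.
           (\<forall>j<SB. (Dz ^^ j) (y i) t 0 e = laplace Ak \<gamma> i (\<lambda>\<tau>. vj j \<tau> e) t e) \<and>
           (\<forall>j<S. (Dz ^^ j) (op_P2 B d PB SB (y i)) t 0 e = laplace Ak \<gamma> i (\<lambda>\<tau>. wj j \<tau> e) t e))) \<and>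
     \<comment> \<open>\<open>op_P1 \<circ> op_P2\<close> is a sum of Moebius operators composed with differential operators whose
         coefficients are polynomial in \<open>t\<close> and holomorphic in \<open>(z, e)\<close>\<close>
     (\<exists>N q. (\<forall>\<kappa> l m i. holo2 (q \<kappa> l m i) (ball 0 \<rho> \<times> ball 0 \<epsilon>0)) \<and>
        (\<forall>U f t z e. open U \<and> U \<subseteq> UNIV \<times> ball 0 \<rho> \<times> ball 0 \<epsilon>0 \<and> holo3 f U \<and>
           (t, z, e) \<in> U \<and> moebius_ok A U t z e \<longrightarrow>
           op_P1 A c P S (op_P2 B d PB SB f) t z e =
           (\<Sum>\<kappa>\<in>insert 0 ((\<lambda>(k0, k1, k2). k2) ` A).
              moebius_op \<kappa> (\<lambda>t z e. \<Sum>l\<le>N. \<Sum>m\<le>N. (\<Sum>i\<le>N. q \<kappa> l m i z e * t ^ i) *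
                (Dt ^^ l) ((Dz ^^ m) f) t z e) t z e)))"
proof -
  let ?\<Omega> = "ball 0 \<rho> \<times> ball 0 \<epsilon>0 :: (complex \<times> complex) set"
  let ?D = "\<lambda>i. sol_dom T rT (\<delta> * \<delta>1) (E i)"
  have \<Omega>: "open ?\<Omega>" by (intro open_Times) auto
  \<comment> \<open>The disc for \<open>z\<close> must lie in the disc of radius \<rho> on which the
    coefficients are holomorphic; with \<open>E_sub\<close> this places each \<open>W i\<close> over
    the coefficient domain.\<close>
  have "\<delta> * \<delta>1 \<le> \<delta> * 1" using delta delta1 by (intro mult_left_mono) auto
  then have R: "0 < \<delta> * \<delta>1" "\<delta> * \<delta>1 < \<rho>" using delta delta1 by (simp, linarith)
  have W\<Omega>: "W i \<subseteq> UNIV \<times> ?\<Omega>" if "i \<in> sector_indices n \<iota>" for i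
    using W[OF that] E_sub[OF that] R by fastforce
  have P2: "diff_op ?\<Omega> (op_P2 B d PB SB)"
    by (rule diff_op_op_P2[OF \<Omega> B d_holo])
  have P2_D: "op_P2 B d PB SB (y i) t z e = u i t z e"
    if "i \<in> sector_indices n \<iota>" "(t, z, e) \<in> ?D i" for i t z e
    using y_eq[OF that] by (simp add: op_P2_def)
  have P2_W: "op_P2 B d PB SB (y i) t z e = u i t z e"
    if i: "i \<in> sector_indices n \<iota>" and x: "(t, z, e) \<in> W i" for i t z e
  proof (rule holo3_identity_theorem[of "W i" z e "op_P2 B d PB SB (y i)" "u i" "min RT rT"])
    show "open (W i)" "connected {t. (t, z, e) \<in> W i}" using W[OF i] by auto
    show "holo3 (op_P2 B d PB SB (y i)) (W i)"
      using diff_op_holo3[OF P2 _ W\<Omega>[OF i] y_holo[OF i]] W[OF i] by blast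
    \<comment> \<open>The bisecting direction of \<open>T\<close> is 0, so short positive reals lie
      in \<open>T\<close>. The conditions on \<open>z\<close> and \<open>e\<close> are inherited
      from \<open>(t, z, e)\<close>, since \<open>W i\<close> projects into the disc times
      \<open>E i\<close>.\<close>
    have D: "(of_real x, z, e) \<in> ?D i" if "0 < x" "x < min RT rT" for x
    proof -
      have "of_real x \<in> T"
        unfolding T(4) bsector_def mem_Collect_eq by (rule exI[of _ x], rule exI[of _ 0]) (use that T(1) in simp)
      then show ?thesis using that W[OF i] x by (auto simp: sol_dom_def)
    qed
    show "0 < min RT rT" using T rT by simp
    show "(of_real x, z, e) \<in> W i" if "0 < x" "x < min RT rT" for x
      using D[OF that] W[OF i] by blast
    show "op_P2 B d PB SB (y i) (of_real x) z e = u i (of_real x) z e" if "0 < x" "x < min RT rT" for x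
      by (rule P2_D[OF i D[OF that]])
  qed (use u_holo[OF i] x in auto)
  have holo: "holo3 (y i) (?D i)" if "i \<in> sector_indices n \<iota>" for i
    using holo3_subset[OF y_holo[OF that]] W[OF that] by blast
  have zero: "op_P1 A c P S (op_P2 B d PB SB (y i)) t z e = 0"
    if i: "i \<in> sector_indices n \<iota>" and x: "(t, z, e) \<in> ?D i" and ok: "moebius_ok A (W i) t z e" for i t z e
  proof -
    \<comment> \<open>Equality on all of \<open>W i\<close> is essential here: the shifted points
      may leave the sectorial domain on which the equation for \<open>y i\<close> is given.\<close>
    have "op_P1 A c P S (op_P2 B d PB SB (y i)) t z e = op_P1 A c P S (u i) t z e"
      by (rule op_P1_cong_open[of "W i", OF _ P2_W[OF i]]) (use W[OF i] x ok in auto)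
    also have "\<dots> = 0"
      using u_eq[OF i x ok] by (simp add: op_P1_def moebius_op_def)
    finally show ?thesis .
  qed
  have init: "(Dz ^^ j) (op_P2 B d PB SB (y i)) t 0 e = laplace Ak \<gamma> i (\<lambda>\<tau>. wj j \<tau> e) t e"
    if i: "i \<in> sector_indices n \<iota>" and x: "t \<in> T \<inter> ball 0 rT" "e \<in> E i" and j: "j < S" for i t e j
  proof -
    \<comment> \<open>The point lies in the open set \<open>W i\<close>, so the equality there may
      be differentiated in \<open>z\<close> at 0.\<close>
    have "(t, 0, e) \<in> W i" using W[OF i] x R by (auto simp: sol_dom_def)
    then have "(Dz ^^ j) (op_P2 B d PB SB (y i)) t 0 e = (Dz ^^ j) (u i) t 0 e"
      using W[OF i] by (intro Dz_power_cong_open[of "W i", OF _ P2_W[OF i]]) auto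
    then show ?thesis using u_init[OF i x j] by simp
  qed
  show ?thesis
  proof (rule conjI, goal_cases)
    case 1
    show ?case using holo zero y_init init by blast
  next
    case 2
    show ?case by (rule op_P1_diff_op_normal_form[OF A \<Omega> c_holo P2])
  qed
qed

end
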